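(* For every integer $n\ge 1$ let $c_2(n)$ denote the number of different $2$-dimensional polyominoes with $n$ cells (counted up to congruence) whose convex hull has the maximum possible area $n+\frac12\left\lfloor\frac{n-1}{2}\right\rfloor\left\lfloor\frac{n}{2}\right\rfloor$. Then $$c_2(n)=\begin{cases}\frac{n^3-2n^2+4n}{16} & \text{if } n\equiv 0 \pmod 4,\\[2pt] \frac{n^3-2n^2+13n+20}{32} & \text{if } n\equiv 1 \pmod 4,\\[2pt] \frac{n^3-2n^2+4n+8}{16} & \text{if } n\equiv 2 \pmod 4,\\[2pt] \frac{n^3-2n^2+5n+8}{32} & \text{if } n\equiv 3 \pmod 4.\end{cases}$$
   Context: A $2$-dimensional polyomino with $n$ cells is an edge-to-edge connected system of $n$ distinct unit squares of the integer grid in $\mathbb{R}^2$: any two of its squares are joined by a chain of squares of the system in which consecutive squares share a full edge. Its convex hull is the convex hull in $\mathbb{R}^2$ of the union of its (closed) squares. Two polyominoes are regarded as the same if one is obtained from the other by a translation, rotation or reflection of the grid. *)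

theory Defs
  imports "HOL-Analysis.Analysis"
begin

text \<open>The cell \<open>(x, y)\<close> stands for the closed unit square whose lower left corner is \<open>(x, y)\<close>.\<close>

type_synonym cell = "int \<times> int"

definition unit_square :: "cell \<Rightarrow> (real \<times> real) set" where
  "unit_square c =
     {of_int (fst c)..of_int (fst c) + 1} \<times> {of_int (snd c)..of_int (snd c) + 1}"

definition region :: "cell set \<Rightarrow> (real \<times> real) set" where
  "region P = (\<Union>c\<in>P. unit_square c)"

definition edge_adjacent :: "cell \<Rightarrow> cell \<Rightarrow> bool" where
  "edge_adjacent c d \<longleftrightarrow> \<bar>fst c - fst d\<bar> + \<bar>snd c - snd d\<bar> = 1"

definition edge_connected :: "cell set \<Rightarrow> bool" where
  "edge_connected P \<longleftrightarrow>
     (\<forall>c\<in>P. \<forall>d\<in>P. (c, d) \<in> {(u, v). u \<in> P \<and> v \<in> P \<and> edge_adjacent u v}\<^sup>*)"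

definition polyominoes :: "nat \<Rightarrow> cell set set" where
  "polyominoes n = {P. finite P \<and> card P = n \<and> edge_connected P}"

definition hull_area :: "cell set \<Rightarrow> real" where
  "hull_area P = measure lebesgue (convex hull (region P))"

definition max_hull_polyominoes :: "nat \<Rightarrow> cell set set" where
  "max_hull_polyominoes n =
     {P \<in> polyominoes n. \<forall>Q\<in>polyominoes n. hull_area Q \<le> hull_area P}"

text \<open>
  The symmetries of the grid are the isometries of the Euclidean plane (translations, rotations,
  reflections and their compositions) that map the set of grid points onto itself; \<open>dist\<close> on
  pairs of reals is the Euclidean distance.
\<close>

definition grid_isometry :: "(real \<times> real \<Rightarrow> real \<times> real) \<Rightarrow> bool" where
  "grid_isometry f \<longleftrightarrow> (\<forall>p q. dist (f p) (f q) = dist p q) \<and> f ` (\<int> \<times> \<int>) = \<int> \<times> \<int>"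

definition congruence :: "(cell set \<times> cell set) set" where
  "congruence = {(P, Q). \<exists>f. grid_isometry f \<and> f ` region P = region Q}"

definition c2 :: "nat \<Rightarrow> nat" where
  "c2 n = card (max_hull_polyominoes n // congruence)"

end

theory Submission
  imports Defs
begin

text \<open>
  Let \<open>K\<close> be the convex hull of the lower left corners of the cells of a polyomino whose bounding box
  has \<open>w + 1\<close> columns and \<open>h + 1\<close> rows. The hull of the polyomino is \<open>K + [0, 1]\<^sup>2\<close>, so its area
  is \<open>area K + w + h + 1\<close>. Attaching a point at distance \<open>1\<close> above a point of \<open>K\<close> lengthens the
  vertical slices of \<open>K\<close> by at most a tent function of height \<open>1\<close>, so it adds at most \<open>w / 2\<close> to
  the area. Hence \<open>area K \<le> p q / 2\<close> if a spanning tree has \<open>p\<close> horizontal and \<open>q\<close> vertical edges,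
  and the maximum forces \<open>w = p\<close>, \<open>h = q\<close>, \<open>\<bar>p - q\<bar> \<le> 1\<close> and equality at every step.
  Following the equality case through the removal of cells shows that an extremal polyomino contains
  a complete row or column of its box; it then consists of this line and two straight arms, and all
  such crosses are extremal. They are counted up to symmetry with Burnside's lemma.
\<close>

section \<open>Areas of planar convex sets via vertical slices\<close>

text \<open>Passing to lower left corners turns the growth of a polyomino into the insertion of
  single points into a hull, each costing at most half the extent of the hull across the step.
  Rigidity in the equality case is used downwards: removing a suitable cell from an extremal set
  must shrink its box by one, so the smaller set is extremal again and induction applies.

  The obstacle in this induction is a cross whose right arm runs along the top row while its left
  arm is lower, and which receives a new cell above the right arm. Then no line is complete any
  more, although the number of cells still fits the box. Such a set contains a hook whose hull falls
  short of half its box by at least 1/2, and the later insertions cannot make up for this loss.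

  In the count, a cross with both a complete column and a complete row would be listed twice, once
  for each orientation. Hence the split into plus shapes, crosses with only a complete column, and
  crosses with only a complete row. Symmetries that exchange the axes occur only for a square box,
  that is for odd \<open>n\<close>; this explains the denominators 32 and 16.\<close>

lemma slice_has_integral_UNIV:
  fixes C :: "(real \<times> real) set"
  assumes C: "compact C"
  shows "((\<lambda>x. measure lborel (Pair x -` C)) has_integral measure lebesgue C) UNIV"
proof -
  have Cb: "C \<in> sets borel"
    using C by (simp add: borel_compact)
  have int: "integrable (lborel \<Otimes>\<^sub>M lborel) (indicator C :: real \<times> real \<Rightarrow> real)"
    unfolding lborel_prod
    using Cb emeasure_bounded_finite[OF compact_imp_bounded[OF C]] by (simp add: less_top)
  have eq: "(\<integral>y. indicator C (x, y) \<partial>lborel) = measure lborel (Pair x -` C)" for x :: real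
  proof -
    have "(\<lambda>y. indicator C (x, y) :: real) = indicator (Pair x -` C)"
      by (auto simp: indicator_def fun_eq_iff)
    then show ?thesis by simp
  qed
  have "integrable lborel (\<lambda>x. measure lborel (Pair x -` C))"
    using lborel_pair.integrable_fst'[OF int] unfolding eq .
  moreover have "(\<integral>x. measure lborel (Pair x -` C) \<partial>lborel) = measure lborel C"
    using lborel_pair.integral_fst'[OF int] unfolding eq lborel_prod using Cb by simp
  ultimately have "((\<lambda>x. measure lborel (Pair x -` C)) has_integral measure lborel C) UNIV"
    using has_integral_integral_lborel by metis
  moreover have "measure lebesgue C = measure lborel C"
    using Cb by (simp add: measure_completion)
  ultimately show ?thesis by simp
qed

text \<open>In this form pointwise estimates of slice lengths become area estimates, by comparing
  integrals over one fixed interval.\<close>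

lemma slice_has_integral:
  fixes C :: "(real \<times> real) set"
  assumes C: "compact C" and ab: "fst ` C \<subseteq> {a..b}"
  shows "((\<lambda>x. measure lborel (Pair x -` C)) has_integral measure lebesgue C) {a..b}"
proof -
  have "measure lborel (Pair x -` C) = (if x \<in> {a..b} then measure lborel (Pair x -` C) else 0)" for x
  proof (cases "x \<in> {a..b}")
    case False
    then have "Pair x -` C = {}" using ab by force
    then show ?thesis using False by simp
  qed auto
  then show ?thesis
    using slice_has_integral_UNIV[OF C] has_integral_restrict_UNIV[of "{a..b}" "\<lambda>x. measure lborel (Pair x -` C)"]
    by simp
qed

lemma compact_slice:
  fixes C :: "(real \<times> real) set"
  assumes "compact C"
  shows "compact (Pair x -` C)"
proof -
  have "Pair x -` C = snd ` (C \<inter> ({x} \<times> UNIV))" by force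
  moreover have "closed ({x} \<times> (UNIV :: real set))" by (intro closed_Times) auto
  then have "compact (snd ` (C \<inter> ({x} \<times> UNIV)))"
    by (intro compact_continuous_image continuous_intros compact_Int_closed assms)
  ultimately show ?thesis by simp
qed

lemma convex_slice:
  fixes C :: "(real \<times> real) set"
  assumes "convex C"
  shows "convex (Pair x -` C)"
proof (rule convexI)
  fix y z u v :: real
  assume *: "y \<in> Pair x -` C" "z \<in> Pair x -` C" "0 \<le> u" "0 \<le> v" "u + v = 1"
  have "u *\<^sub>R (x, y) + v *\<^sub>R (x, z) \<in> C"
    using * by (intro convexD[OF assms]) auto
  moreover have "u *\<^sub>R (x, y) + v *\<^sub>R (x, z) = (x, u *\<^sub>R y + v *\<^sub>R z)"
    using * by (simp flip: distrib_right)
  ultimately show "u *\<^sub>R y + v *\<^sub>R z \<in> Pair x -` C" by simp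
qed

lemma slice_interval:
  fixes C :: "(real \<times> real) set"
  assumes "compact C" "convex C" "x \<in> fst ` C"
  obtains l u where "l \<le> u" "Pair x -` C = {l..u}"
proof -
  have "connected (Pair x -` C)" "compact (Pair x -` C)"
    using convex_slice[OF assms(2)] compact_slice[OF assms(1)] convex_connected by blast+
  then obtain l u where lu: "Pair x -` C = {l..u}"
    using connected_compact_interval_1 by (metis cbox_interval)
  moreover have "Pair x -` C \<noteq> {}" using assms(3) by force
  ultimately show ?thesis using that by auto
qed

lemma measure_slice_le:
  fixes C :: "(real \<times> real) set"
  assumes "compact C" "Pair x -` C \<subseteq> {l..u}" "l \<le> u"
  shows "measure lborel (Pair x -` C) \<le> u - l"
proof -
  have "measure lborel (Pair x -` C) \<le> measure lborel {l..u}"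
    using assms(2) compact_slice[OF assms(1)]
    by (intro measure_mono_fmeasurable fmeasurable_compact) (auto simp: borel_compact)
  then show ?thesis using assms(3) by simp
qed

lemma measure_slice_ge:
  fixes C :: "(real \<times> real) set"
  assumes "compact C" "{l..u} \<subseteq> Pair x -` C"
  shows "u - l \<le> measure lborel (Pair x -` C)"
proof (cases "l \<le> u")
  case True
  have "measure lborel {l..u} \<le> measure lborel (Pair x -` C)"
    using assms(2) compact_slice[OF assms(1)]
    by (intro measure_mono_fmeasurable fmeasurable_compact) auto
  then show ?thesis using True by simp
\<comment> \<open>For \<open>u < l\<close> the left side is negative.\<close>
qed (simp add: order_trans[OF _ measure_nonneg])

text \<open>Transposition carries results about vertical slices over to horizontal ones, so only one
  direction has to be treated.\<close>

lemma measure_swap: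
  fixes C :: "(real \<times> real) set"
  assumes "compact C"
  shows "measure lebesgue (prod.swap ` C) = measure lebesgue C"
proof -
  have Cb: "C \<in> sets borel" "prod.swap ` C \<in> sets borel"
    using assms by (auto intro!: borel_compact compact_continuous_image continuous_intros)
  have "measure lborel C = measure (distr (lborel \<Otimes>\<^sub>M lborel) (lborel \<Otimes>\<^sub>M lborel) (\<lambda>(x, y). (y, x))) C"
    using lborel_pair.distr_pair_swap lborel_prod by metis
  also have "\<dots> = measure (lborel \<Otimes>\<^sub>M lborel) ((\<lambda>(x, y). (y, x)) -` C \<inter> space (lborel \<Otimes>\<^sub>M lborel))"
    using Cb by (intro measure_distr measurable_pair_swap') (metis lborel_prod sets_lborel)
  also have "(\<lambda>(x, y). (y, x)) -` C \<inter> space (lborel \<Otimes>\<^sub>M lborel) = prod.swap ` C"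
    by (force simp: space_pair_measure)
  also have "measure (lborel \<Otimes>\<^sub>M lborel) (prod.swap ` C) = measure lborel (prod.swap ` C)"
    by (simp add: lborel_prod)
  finally show ?thesis using Cb by (simp add: measure_completion)
qed

text \<open>The slice of the image at \<open>x\<close> is the slice of \<open>C\<close> at
  \<open>- x\<close>, so both areas are the same integral after a change of sign.\<close>

lemma measure_reflect:
  fixes C :: "(real \<times> real) set"
  assumes "compact C"
  shows "measure lebesgue ((\<lambda>(x, y). (- x, y)) ` C) = measure lebesgue C"
proof -
  let ?D = "(\<lambda>(x, y). (- x, y)) ` C"
  have D: "compact ?D"
    using assms by (auto intro!: compact_continuous_image continuous_intros simp: case_prod_beta)
  have "bounded (fst ` C)"
    using assms by (intro compact_imp_bounded compact_continuous_image continuous_intros)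
  then obtain r where "\<forall>x\<in>fst ` C. norm x \<le> r" unfolding bounded_iff by blast
  then have r: "fst ` C \<subseteq> {- r..r}" "fst ` ?D \<subseteq> {- r..r}" by force+
  have eq: "Pair x -` ?D = Pair (- x) -` C" for x by force
  have "((\<lambda>x. measure lborel (Pair (- x) -` C)) has_integral measure lebesgue ?D) {- r..r}"
    using slice_has_integral[OF D r(2)] unfolding eq .
  moreover have "((\<lambda>x. measure lborel (Pair (- x) -` C)) has_integral measure lebesgue C) {- r..r}"
    using has_integral_reflect_real[of "\<lambda>x. measure lborel (Pair x -` C)" "measure lebesgue C" r "- r"]
      slice_has_integral[OF assms r(1)] by simp
  ultimately show ?thesis by (rule has_integral_unique)
qed

section \<open>Tent functions and the area gained by a new vertex\<close>

lemma affine_has_integral: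
  fixes a b c d :: real
  assumes "a \<le> b"
  shows "((\<lambda>x. c + d * x) has_integral (c * (b - a) + d * (b\<^sup>2 - a\<^sup>2) / 2)) {a..b}"
proof -
  have 1: "((\<lambda>x. c) has_integral c * (b - a)) {a..b}"
    using has_integral_const_real[of c a b] assms by (simp add: mult.commute)
  have 2: "((\<lambda>x. d * x) has_integral d * ((b\<^sup>2 - a\<^sup>2) / 2)) {a..b}"
    using ident_has_integral[OF assms] by (rule has_integral_mult_right)
  show ?thesis using has_integral_add[OF 1 2] by simp
qed

text \<open>The separate value at \<open>x = p\<close> keeps the apex at height 1 even for
  \<open>p = b\<close>, where the right quotient would be 0 / 0 = 0.\<close>

definition tent :: "real \<Rightarrow> real \<Rightarrow> real \<Rightarrow> real \<Rightarrow> real" where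
  "tent a b p x = (if x < p then (x - a) / (p - a) else if x = p then 1 else (b - x) / (b - p))"

lemma tent_has_integral:
  assumes "a \<le> p" "p \<le> b"
  shows "(tent a b p has_integral (b - a) / 2) {a..b}"
proof -
  have 1: "(tent a b p has_integral (p - a) / 2) {a..p}"
  proof (cases "a = p")
    case False
    then have ap: "a < p" using assms by simp
    have int: "((\<lambda>x. - a / (p - a) + 1 / (p - a) * x) has_integral
        (- a / (p - a) * (p - a) + 1 / (p - a) * (p\<^sup>2 - a\<^sup>2) / 2)) {a..p}"
      using ap by (intro affine_has_integral) simp
    have "1 / (p - a) * (p\<^sup>2 - a\<^sup>2) / 2 = (p + a) / 2"
      using ap by (simp add: power2_eq_square square_diff_square_factored)
    moreover have "- a / (p - a) * (p - a) = - a"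
      using ap by simp
    ultimately have val: "- a / (p - a) * (p - a) + 1 / (p - a) * (p\<^sup>2 - a\<^sup>2) / 2 = (p - a) / 2"
      by (simp only:) (simp add: field_simps)
    have eq: "- a / (p - a) + 1 / (p - a) * x = tent a b p x" if "x \<in> {a..p}" for x
    proof -
      have "- a / (p - a) + 1 / (p - a) * x = (x - a) / (p - a)" by (simp add: diff_divide_distrib)
      then show ?thesis using ap that by (auto simp: tent_def)
    qed
    show ?thesis by (rule has_integral_eq[OF eq int[unfolded val]])
  qed (use has_integral_refl(2) in auto)
  have 2: "(tent a b p has_integral (b - p) / 2) {p..b}"
  proof (cases "b = p")
    case False
    then have ap: "p < b" using assms by simp
    have int: "((\<lambda>x. b / (b - p) + (- 1 / (b - p)) * x) has_integral
        (b / (b - p) * (b - p) + (- 1 / (b - p)) * (b\<^sup>2 - p\<^sup>2) / 2)) {p..b}"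
      using ap by (intro affine_has_integral) simp
    have sum: "u + v = (b - p) / 2" if "v = - (b + p) / 2" "u = b" for u v :: real
      using that by (simp add: field_simps)
    have "(- 1 / (b - p)) * (b\<^sup>2 - p\<^sup>2) / 2 = - (b + p) / 2"
      using ap by (simp add: power2_eq_square square_diff_square_factored)
    moreover have "b / (b - p) * (b - p) = b"
      using ap by simp
    ultimately have val: "b / (b - p) * (b - p) + (- 1 / (b - p)) * (b\<^sup>2 - p\<^sup>2) / 2 = (b - p) / 2"
      by (rule sum)
    have eq: "b / (b - p) + (- 1 / (b - p)) * x = tent a b p x" if "x \<in> {p..b}" for x
    proof -
      have "b / (b - p) + (- 1 / (b - p)) * x = (b - x) / (b - p)" by (simp add: diff_divide_distrib)
      then show ?thesis using ap that by (auto simp: tent_def)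
    qed
    show ?thesis by (rule has_integral_eq[OF eq int[unfolded val]])
  qed (use has_integral_refl(2) in auto)
  have "(tent a b p has_integral (p - a) / 2 + (b - p) / 2) {a..b}"
    by (rule has_integral_combine[OF assms 1 2])
  then show ?thesis by (simp add: field_simps)
qed

lemma tent_bounds:
  assumes "a \<le> x" "x \<le> b"
  shows "0 \<le> tent a b p x" "tent a b p x \<le> 1"
  using assms by (auto simp: tent_def field_simps)

text \<open>The two product hypotheses are the linear bounds from the two feet with denominators
  cleared, so they also make sense when one side of the tent is degenerate.\<close>

lemma le_tent:
  assumes "a \<le> x" "x \<le> b" "c \<le> 1" "c * (p - a) \<le> x - a" "c * (b - p) \<le> b - x"
  shows "c \<le> tent a b p x"
  using assms by (auto simp: tent_def field_simps)

text \<open>A point of the new hull is a convex combination of the new vertex, with weight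
  \<open>u\<close>, and a point of \<open>K\<close>. Replacing the new vertex by
  \<open>(p, q)\<close> gives a point of \<open>K\<close> with the same abscissa, shifted vertically
  by \<open>u * s\<close>. The abscissa limits \<open>u\<close> by the tent with apex at
  \<open>p\<close>, whose integral is half its base.\<close>

lemma measure_hull_insert_vertical:
  fixes K :: "(real \<times> real) set"
  assumes K: "compact K" "convex K" "(p, q) \<in> K" and ab: "fst ` K \<subseteq> {a..b}"
  shows "measure lebesgue (convex hull insert (p, q + s) K) \<le> measure lebesgue K + \<bar>s\<bar> * ((b - a) / 2)"
proof -
  let ?K' = "convex hull insert (p, q + s) K"
  have K': "compact ?K'" "convex ?K'"
    using K by (auto intro!: compact_convex_hull)
  have pab: "a \<le> p" "p \<le> b" using K(3) ab by force+
  have shift: "\<exists>y c. (fst z, y) \<in> K \<and> snd z = y + c * s \<and> 0 \<le> c \<and> c \<le> tent a b p (fst z) \<and> fst z \<in> {a..b}"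
    if "z \<in> ?K'" for z
  proof -
    have "K \<noteq> {}" "convex hull K = K" using K by (auto simp: convex_hull_eq)
    then have "\<exists>u\<ge>0. \<exists>v\<ge>0. \<exists>k. u + v = 1 \<and> k \<in> K \<and> z = u *\<^sub>R (p, q + s) + v *\<^sub>R k"
      using that convex_hull_insert[of K "(p, q + s)"] by auto
    then obtain u v k where z: "z = u *\<^sub>R (p, q + s) + v *\<^sub>R k" "0 \<le> u" "0 \<le> v" "u + v = 1" "k \<in> K"
      by blast
    have k: "a \<le> fst k" "fst k \<le> b" using z(5) ab by force+
    let ?y = "snd (u *\<^sub>R (p, q) + v *\<^sub>R k)"
    have "u *\<^sub>R (p, q) + v *\<^sub>R k \<in> K" using z K by (intro convexD) auto
    moreover have "(fst z, ?y) = u *\<^sub>R (p, q) + v *\<^sub>R k" by (simp add: prod_eq_iff z(1))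
    ultimately have y: "(fst z, ?y) \<in> K" by simp
    then have fz: "fst z \<in> {a..b}" using ab by force
    have v: "v = 1 - u" using z by simp
    have "v * (fst k - a) \<ge> 0" "v * (b - fst k) \<ge> 0" using k z by auto
    then have "u \<le> tent a b p (fst z)"
      using fz z(3) by (intro le_tent) (auto simp: z(1) v algebra_simps)
    then show ?thesis
      using y z fz by (intro exI[of _ ?y] exI[of _ u]) (auto simp: algebra_simps)
  qed
  have ab': "fst ` ?K' \<subseteq> {a..b}" using shift by blast
  have "measure lborel (Pair x -` ?K') \<le> measure lborel (Pair x -` K) + \<bar>s\<bar> * tent a b p x"
    if x: "x \<in> {a..b}" for x
  proof (cases "x \<in> fst ` ?K'")
    case False
    then have "Pair x -` ?K' = {}" by force
    then show ?thesis using tent_bounds[of a x b p] x by simp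
  next
    case True
    then have "x \<in> fst ` K" using shift by force
    then obtain l u where lu: "l \<le> u" "Pair x -` K = {l..u}" using slice_interval K by metis
    let ?t = "tent a b p x"
    have t: "0 \<le> ?t" using tent_bounds[of a x b p] x by simp
    \<comment> \<open>All shifts have the sign of \<open>s\<close>, so only one end of the slice
      moves; moving both ends would double the gain.\<close>
    have "Pair x -` ?K' \<subseteq> {l + min 0 (?t * s) .. u + max 0 (?t * s)}"
    proof
      fix y' assume "y' \<in> Pair x -` ?K'"
      then obtain y c where yc: "(x, y) \<in> K" "y' = y + c * s" "0 \<le> c" "c \<le> ?t"
        using shift[of "(x, y')"] by auto
      then have "y \<in> {l..u}" using lu by auto
      moreover have "min 0 (?t * s) \<le> c * s \<and> c * s \<le> max 0 (?t * s)"
      proof (cases "s \<ge> 0")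
        case True
        then have "c * s \<le> ?t * s" "0 \<le> c * s" using yc by (auto intro: mult_right_mono)
        then show ?thesis by auto
      next
        case False
        then have "?t * s \<le> c * s" "c * s \<le> 0" using yc by (auto intro: mult_right_mono_neg simp: mult_le_0_iff)
        then show ?thesis by auto
      qed
      ultimately show "y' \<in> {l + min 0 (?t * s) .. u + max 0 (?t * s)}" using yc by auto
    qed
    then have "measure lborel (Pair x -` ?K') \<le> (u + max 0 (?t * s)) - (l + min 0 (?t * s))"
      using lu by (intro measure_slice_le K') auto
    also have "\<dots> = u - l + \<bar>?t * s\<bar>" using lu by (auto simp: min_def max_def)
    also have "\<dots> = measure lborel (Pair x -` K) + \<bar>s\<bar> * ?t" using lu t by (simp add: abs_mult)
    finally show ?thesis .
  qed
  note le = this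
  have int:  "((\<lambda>x. measure lborel (Pair x -` K) + \<bar>s\<bar> * tent a b p x) has_integral
      measure lebesgue K + \<bar>s\<bar> * ((b - a) / 2)) {a..b}"
    by (intro has_integral_add slice_has_integral[OF K(1) ab] has_integral_mult_right tent_has_integral pab)
  show ?thesis
    by (rule has_integral_le[OF slice_has_integral[OF K'(1) ab'] int le])
qed

lemma measure_set_plus_vertical:
  fixes K :: "(real \<times> real) set"
  assumes K: "compact K" "convex K" "K \<noteq> {}" and ab: "fst ` K = {a..b}"
  shows "measure lebesgue (K + {0} \<times> {0..1}) = measure lebesgue K + (b - a)"
proof -
  let ?K' = "K + {0} \<times> {0..1::real}"
  have "{0::real} \<times> {0..1::real} = cbox (0, 0) (0, 1)" by auto
  then have "compact ({0::real} \<times> {0..1::real})" by (metis compact_cbox)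
  then have "compact {x + y | x y. x \<in> K \<and> y \<in> {0} \<times> {0..1}}"
    by (rule compact_sums[OF K(1)])
  moreover have "{x + y | x y. x \<in> K \<and> y \<in> {0} \<times> {0..1}} = ?K'"
    unfolding set_plus_def by blast
  ultimately have K': "compact ?K'" by simp
  have ab': "fst ` ?K' \<subseteq> {a..b}" using ab by (force simp: set_plus_def)
  have ab0: "a \<le> b" using K ab by auto
  have "measure lborel (Pair x -` ?K') = measure lborel (Pair x -` K) + 1" if x: "x \<in> {a..b}" for x
  proof -
    obtain l u where lu: "l \<le> u" "Pair x -` K = {l..u}" using slice_interval[of K x] K x ab by metis
    have "Pair x -` ?K' = {l..u+1}"
    proof (intro set_eqI iffI)
      fix y assume "y \<in> Pair x -` ?K'"
      then obtain y0 r where "(x, y0) \<in> K" "r \<in> {0..1}" "y = y0 + r" by (auto simp: set_plus_def)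
      moreover from this have "y0 \<in> {l..u}" using lu by auto
      ultimately show "y \<in> {l..u+1}" by auto
    next
      fix y assume y: "y \<in> {l..u+1}"
      \<comment> \<open>The highest point of the slice not above \<open>y\<close> leaves a remainder
        in \<open>[0, 1]\<close>.\<close>
      have "min y u \<in> Pair x -` K" using lu y by auto
      moreover have "(0, y - min y u) \<in> {0} \<times> {0..1::real}" using y by auto
      moreover have "(x, y) = (x, min y u) + (0, y - min y u)" by simp
      ultimately show "y \<in> Pair x -` ?K'" unfolding vimage_eq by (metis set_plus_intro vimage_eq)
    qed
    then show ?thesis using lu by simp
  qed
  moreover have "((\<lambda>x. measure lborel (Pair x -` K) + 1) has_integral measure lebesgue K + (b - a)) {a..b}"
    using slice_has_integral[OF K(1), of a b] has_integral_const_real[of "1::real" a b] ab ab0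
    by (intro has_integral_add) auto
  ultimately have "((\<lambda>x. measure lborel (Pair x -` ?K')) has_integral measure lebesgue K + (b - a)) {a..b}"
    using has_integral_eq by (metis (no_types, lifting))
  then show ?thesis using slice_has_integral[OF K' ab'] has_integral_unique by blast
qed

section \<open>The hull of a polyomino and of its lower left corners\<close>

definition corner :: "cell \<Rightarrow> real \<times> real" where
  "corner c = (of_int (fst c), of_int (snd c))"

definition corner_area :: "cell set \<Rightarrow> real" where
  "corner_area S = measure lebesgue (convex hull (corner ` S))"

text \<open>Measured between lower left corners, hence one less than the number of columns from the
  first to the last.\<close>

definition width :: "cell set \<Rightarrow> int" where
  "width S = Max (fst ` S) - Min (fst ` S)"

definition height :: "cell set \<Rightarrow> int" where
  "height S = Max (snd ` S) - Min (snd ` S)"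

text \<open>Reflects the lower left corner; the reflected square would have its corner at
  \<open>- fst c - 1\<close>. For hulls of corners the difference is only a translation.\<close>

definition negx :: "cell \<Rightarrow> cell" where
  "negx c = (- fst c, snd c)"

lemma corner_simps [simp]: "corner (x, y) = (of_int x, of_int y)"
  by (simp add: corner_def)

lemma compact_hull_corner: "finite S \<Longrightarrow> compact (convex hull (corner ` S))"
  by (simp add: finite_imp_compact_convex_hull)

lemma corner_swap: "corner ` prod.swap ` S = prod.swap ` corner ` S"
  unfolding image_image by (intro image_cong) (auto simp: corner_def)

lemma hull_swap: "convex hull (prod.swap ` A) = prod.swap ` (convex hull A)"
  for A :: "(real \<times> real) set"
proof -
  have "linear (prod.swap :: real \<times> real \<Rightarrow> real \<times> real)"
    by (intro linearI) auto
  then show ?thesis by (simp add: convex_hull_linear_image)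
qed

lemma hull_reflect: "convex hull ((\<lambda>(x, y). (- x, y)) ` A) = (\<lambda>(x, y). (- x, y)) ` (convex hull A)"
  for A :: "(real \<times> real) set"
proof -
  have "linear (\<lambda>(x, y). (- x, y) :: real \<times> real)"
    by (intro linearI) auto
  then show ?thesis by (simp add: convex_hull_linear_image)
qed

lemma corner_area_swap: "finite S \<Longrightarrow> corner_area (prod.swap ` S) = corner_area S"
  unfolding corner_area_def corner_swap hull_swap by (intro measure_swap compact_hull_corner)

lemma corner_area_negx: "finite S \<Longrightarrow> corner_area (negx ` S) = corner_area S"
proof -
  assume S: "finite S"
  have "corner ` negx ` S = (\<lambda>(x, y). (- x, y)) ` corner ` S"
    by (force simp: corner_def negx_def image_iff)
  then show ?thesis
    unfolding corner_area_def by (simp add: hull_reflect measure_reflect compact_hull_corner S)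
qed

lemma corner_area_translate: "corner_area ((+) v ` S) = corner_area S"
proof -
  have "corner ` (+) v ` S = (+) (corner v) ` corner ` S"
    unfolding image_image by (intro image_cong) (auto simp: corner_def)
  then show ?thesis
    unfolding corner_area_def by (simp add: convex_hull_translation measure_translation)
qed

lemma width_swap: "width (prod.swap ` S) = height S"
  by (simp add: width_def height_def image_image)

lemma height_swap: "height (prod.swap ` S) = width S"
  by (simp add: width_def height_def image_image)

lemma fst_hull:
  fixes A :: "(real \<times> real) set"
  assumes "finite A" "A \<noteq> {}"
  shows "fst ` (convex hull A) = {Min (fst ` A)..Max (fst ` A)}"
proof -
  have "fst ` (convex hull A) = convex hull (fst ` A)"
    by (simp add: convex_hull_linear_image linear_fst)
  also have "\<dots> = {Min (fst ` A)..Max (fst ` A)}"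
  proof
    show "convex hull (fst ` A) \<subseteq> {Min (fst ` A)..Max (fst ` A)}"
      using assms(1) by (intro hull_minimal subsetI) (simp_all add: Min_le Max_ge del: image_iff)
    have "Min (fst ` A) \<in> fst ` A" "Max (fst ` A) \<in> fst ` A" "Min (fst ` A) \<le> Max (fst ` A)"
      using assms by (auto intro!: Min_in Max_in Min_le) 
    then have "closed_segment (Min (fst ` A)) (Max (fst ` A)) \<subseteq> convex hull (fst ` A)"
      by (intro closed_segment_subset_convex_hull) (auto intro: hull_inc)
    then show "{Min (fst ` A)..Max (fst ` A)} \<subseteq> convex hull (fst ` A)"
      using \<open>Min (fst ` A) \<le> Max (fst ` A)\<close> by (simp add: closed_segment_eq_real_ivl)
  qed
  finally show ?thesis .
qed

lemma fst_hull_corner: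
  assumes "finite S" "S \<noteq> {}"
  shows "fst ` (convex hull (corner ` S)) = {of_int (Min (fst ` S))..of_int (Max (fst ` S))}"
proof -
  have "fst ` corner ` S = of_int ` fst ` S" by (force simp: corner_def)
  then show ?thesis
    using fst_hull[of "corner ` S"] assms
      mono_Min_commute[of "of_int :: int \<Rightarrow> real" "fst ` S"]
      mono_Max_commute[of "of_int :: int \<Rightarrow> real" "fst ` S"]
    by (simp add: mono_def)
qed

lemma snd_hull_corner:
  assumes "finite S" "S \<noteq> {}"
  shows "snd ` (convex hull (corner ` S)) = {of_int (Min (snd ` S))..of_int (Max (snd ` S))}"
proof -
  have "snd ` (convex hull (corner ` S)) = fst ` (convex hull (corner ` prod.swap ` S))"
    unfolding corner_swap hull_swap by (simp add: image_image)
  also have "\<dots> = {of_int (Min (fst ` prod.swap ` S))..of_int (Max (fst ` prod.swap ` S))}"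
    using assms by (intro fst_hull_corner) auto
  finally show ?thesis by (simp add: image_image)
qed

text \<open>A unit square is the sum of two unit segments, so its effect on the area can be computed
  in two steps, each along one axis.\<close>

lemma region_eq: "region S = corner ` S + {0} \<times> {0..1} + {0..1} \<times> {0}"
proof -
  have "z \<in> region S \<longleftrightarrow> z \<in> corner ` S + {0} \<times> {0..1} + {0..1} \<times> {0}" for z
  proof
    assume "z \<in> region S"
    then obtain c where c: "c \<in> S" "z \<in> unit_square c" by (auto simp: region_def)
    have "z = corner c + (0, snd z - of_int (snd c)) + (fst z - of_int (fst c), 0)"
      by (simp add: corner_def prod_eq_iff)
    moreover have "(0, snd z - of_int (snd c)) \<in> {0} \<times> {0..1::real}"
      "(fst z - of_int (fst c), 0) \<in> {0..1::real} \<times> {0}"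
      using c(2) by (auto simp: unit_square_def)
    ultimately show "z \<in> corner ` S + {0} \<times> {0..1} + {0..1} \<times> {0}"
      using set_plus_intro[OF set_plus_intro[OF imageI[OF c(1), of corner]]] by metis
  next
    assume "z \<in> corner ` S + {0} \<times> {0..1} + {0..1} \<times> {0}"
    then show "z \<in> region S"
      by (force simp: set_plus_def region_def unit_square_def corner_def)
  qed
  then show ?thesis by blast
qed

text \<open>Convex hulls commute with Minkowski sums, so the two segments are added to the hull of
  the corners; transposition makes the horizontal one vertical.\<close>

lemma hull_area_eq:
  assumes S: "finite S" "S \<noteq> {}"
  shows "hull_area S = corner_area S + of_int (width S) + of_int (height S) + 1"
proof -
  let ?K = "convex hull (corner ` S)"
  let ?V = "{0::real} \<times> {0..1::real}"
  let ?H = "{0..1::real} \<times> {0::real}"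
  let ?L = "?K + ?V"
  have K: "compact ?K" "convex ?K" "?K \<noteq> {}"
    using S by (auto intro: compact_hull_corner)
  have cV: "convex ?V" "convex ?H" by (auto intro: convex_Times)
  have V: "?V = cbox (0, 0) (0, 1)" by auto
  have "compact {x + y | x y. x \<in> ?K \<and> y \<in> ?V}"
    unfolding V using K by (intro compact_sums) auto
  moreover have "{x + y | x y. x \<in> ?K \<and> y \<in> ?V} = ?L"
    unfolding set_plus_def by blast
  ultimately have L: "compact ?L" by simp
  have cL: "convex ?L" using K cV by (intro convex_set_plus)
  have "convex hull (region S) = ?L + ?H"
    using cV by (simp add: region_eq convex_hull_set_plus hull_same)
  moreover have "prod.swap ` (?L + ?H) = prod.swap ` ?L + ?V"
    by (force simp: set_plus_def image_iff)
  moreover have "compact (?L + ?H)"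
  proof -
    have H: "?H = cbox (0, 0) (1, 0)" by auto
    have "compact {x + y | x y. x \<in> ?L \<and> y \<in> ?H}"
      unfolding H using L by (intro compact_sums) auto
    moreover have "{x + y | x y. x \<in> ?L \<and> y \<in> ?H} = ?L + ?H"
      unfolding set_plus_def by blast
    ultimately show ?thesis by simp
  qed
  ultimately have "hull_area S = measure lebesgue (prod.swap ` ?L + ?V)"
    unfolding hull_area_def using measure_swap[of "?L + ?H"] by simp
  \<comment> \<open>The first segment has already raised the vertical extent to
    \<open>height S + 1\<close>, which is the source of the final \<open>+ 1\<close>.\<close>
  also have "\<dots> = measure lebesgue (prod.swap ` ?L) + (of_int (Max (snd ` S)) + 1 - of_int (Min (snd ` S)))"
  proof (rule measure_set_plus_vertical)
    show "compact (prod.swap ` ?L)"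
      using L by (intro compact_continuous_image continuous_intros) auto
    show "convex (prod.swap ` ?L)"
      using cL by (metis convex_hull_eq hull_swap)
    obtain k where "k \<in> ?K" using K by blast
    then have "k + (0, 0) \<in> ?L" by (rule set_plus_intro) simp
    then show "prod.swap ` ?L \<noteq> {}" by blast
    have "fst ` prod.swap ` ?L = snd ` ?L" by (simp add: image_image)
    also have "\<dots> = snd ` ?K + {0..1}"
      by (force simp: set_plus_def image_iff)
    also have "\<dots> = {of_int (Min (snd ` S))..of_int (Max (snd ` S))} + {0..1}"
      using S by (simp add: snd_hull_corner)
    also have "\<dots> = {of_int (Min (snd ` S))..of_int (Max (snd ` S)) + 1}"
    proof (intro set_eqI iffI)
      fix y :: real assume y: "y \<in> {of_int (Min (snd ` S))..of_int (Max (snd ` S)) + 1}"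
      have le: "of_int (Min (snd ` S)) \<le> (of_int (Max (snd ` S)) :: real)"
        using S by simp
      have "min y (of_int (Max (snd ` S))) \<in> {of_int (Min (snd ` S))..of_int (Max (snd ` S))}"
        "y - min y (of_int (Max (snd ` S))) \<in> {0..1}"
        using y le by auto
      moreover have "y = min y (of_int (Max (snd ` S))) + (y - min y (of_int (Max (snd ` S))))" by simp
      ultimately show "y \<in> {of_int (Min (snd ` S))..of_int (Max (snd ` S))} + {0..1}"
        by (metis set_plus_intro)
    qed (auto simp: set_plus_def)
    finally show "fst ` prod.swap ` ?L = {of_int (Min (snd ` S))..of_int (Max (snd ` S)) + 1}" .
  qed
  also have "measure lebesgue (prod.swap ` ?L) = measure lebesgue ?L"
    using L by (rule measure_swap)
  also have "measure lebesgue ?L = measure lebesgue ?K + (of_int (Max (fst ` S)) - of_int (Min (fst ` S)))"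
    using S K by (intro measure_set_plus_vertical fst_hull_corner)
  finally show ?thesis
    by (simp add: corner_area_def width_def height_def)
qed

text \<open>The step \<open>s\<close> may be long: unit steps drive the induction on cells, longer
  ones attach the end of a whole arm at once.\<close>

lemma corner_area_insert_vertical:
  assumes S: "finite S" "(x, y) \<in> S"
  shows "corner_area (insert (x, y + s) S) \<le> corner_area S + of_int (\<bar>s\<bar> * width S) / 2"
proof -
  have "S \<noteq> {}" using S by auto
  have "convex hull (corner ` insert (x, y + s) S)
      = convex hull (insert (of_int x, of_int y + of_int s) (convex hull (corner ` S)))"
    using hull_insert[of convex "(of_int x, of_int y + of_int s)" "corner ` S"] by simp
  moreover have "(of_int x, of_int y) \<in> convex hull (corner ` S)"
    using S by (intro hull_inc) (force simp: image_iff)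
  then have "measure lebesgue (convex hull insert (of_int x, of_int y + of_int s) (convex hull (corner ` S)))
      \<le> measure lebesgue (convex hull (corner ` S)) +
        \<bar>of_int s\<bar> * ((of_int (Max (fst ` S)) - of_int (Min (fst ` S))) / 2)"
    using S \<open>S \<noteq> {}\<close> fst_hull_corner[of S]
    by (intro measure_hull_insert_vertical compact_hull_corner) auto
  ultimately show ?thesis by (simp add: corner_area_def width_def)
qed

lemma corner_area_insert_horizontal:
  assumes S: "finite S" "(x, y) \<in> S"
  shows "corner_area (insert (x + s, y) S) \<le> corner_area S + of_int (\<bar>s\<bar> * height S) / 2"
proof -
  have "corner_area (insert (y, x + s) (prod.swap ` S)) \<le>
      corner_area (prod.swap ` S) + of_int (\<bar>s\<bar> * width (prod.swap ` S)) / 2"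
    using S by (intro corner_area_insert_vertical) force+
  moreover have "corner_area (insert (y, x + s) (prod.swap ` S)) = corner_area (insert (x + s, y) S)"
    using corner_area_swap[of "insert (x + s, y) S"] S(1) by simp
  ultimately show ?thesis
    using corner_area_swap[OF S(1)] by (simp add: width_swap)
qed

section \<open>Edge-connected sets and the area bound\<close>

lemma edge_adjacent_sym: "edge_adjacent c d \<Longrightarrow> edge_adjacent d c"
  by (auto simp: edge_adjacent_def)

lemma edge_adjacent_cases:
  assumes "edge_adjacent (x, y) d"
  obtains s where "\<bar>s\<bar> = 1" "d = (x + s, y)" | s where "\<bar>s\<bar> = 1" "d = (x, y + s)"
proof -
  obtain u v where d: "d = (u, v)" by fastforce
  have "\<bar>u - x\<bar> = 1 \<and> v = y \<or> u = x \<and> \<bar>v - y\<bar> = 1"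
    using assms unfolding edge_adjacent_def d by auto
  then show ?thesis using that(1)[of "u - x"] that(2)[of "v - y"] d by auto
qed

lemma edge_connected_exit:
  assumes "edge_connected S" "c \<in> S" "c \<in> T" "d \<in> S" "d \<notin> T"
  obtains u v where "u \<in> S" "u \<in> T" "v \<in> S" "v \<notin> T" "edge_adjacent u v"
proof -
  have "(c, d) \<in> {(u, v). u \<in> S \<and> v \<in> S \<and> edge_adjacent u v}\<^sup>*"
    using assms by (auto simp: edge_connected_def)
  then have "d \<notin> T \<longrightarrow> (\<exists>u v. u \<in> S \<and> u \<in> T \<and> v \<in> S \<and> v \<notin> T \<and> edge_adjacent u v)"
    using assms(3) by (induction rule: rtrancl_induct) auto
  then show ?thesis using assms that by blast
qed

lemma edge_connectedI:
  assumes "\<And>d. d \<in> S \<Longrightarrow> (d, c) \<in> {(u, v). u \<in> S \<and> v \<in> S \<and> edge_adjacent u v}\<^sup>*"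
  shows "edge_connected S"
proof -
  let ?R = "{(u, v). u \<in> S \<and> v \<in> S \<and> edge_adjacent u v}"
  have "sym (?R\<^sup>*)"
    by (intro sym_rtrancl) (auto simp: sym_def intro: edge_adjacent_sym)
  then have "(c, d) \<in> ?R\<^sup>*" if "d \<in> S" for d
    using assms[OF that] by (meson symD)
  then show ?thesis
    using assms unfolding edge_connected_def by (meson rtrancl_trans)
qed

lemma edge_connected_singleton: "edge_connected {c}"
  by (simp add: edge_connected_def)

lemma edge_connected_insert:
  assumes "edge_connected S" "t \<in> S" "edge_adjacent t p"
  shows "edge_connected (insert p S)"
proof (rule edge_connectedI)
  let ?R = "\<lambda>S. {(u, v). u \<in> S \<and> v \<in> S \<and> edge_adjacent u v}"
  fix d assume "d \<in> insert p S"
  moreover have "(d, t) \<in> (?R (insert p S))\<^sup>*" if "d \<in> S"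
  proof -
    have "(d, t) \<in> (?R S)\<^sup>*" using assms that by (auto simp: edge_connected_def)
    moreover have "?R S \<subseteq> ?R (insert p S)" by auto
    ultimately show ?thesis using rtrancl_mono by blast
  qed
  moreover have "(p, t) \<in> ?R (insert p S)" using assms edge_adjacent_sym by auto
  ultimately show "(d, t) \<in> (?R (insert p S))\<^sup>*" by auto
qed

lemma edge_connected_image:
  assumes S: "edge_connected S" and f: "\<And>c d. edge_adjacent c d \<Longrightarrow> edge_adjacent (f c) (f d)"
  shows "edge_connected (f ` S)"
proof -
  have "(f c, f d) \<in> {(u, v). u \<in> f ` S \<and> v \<in> f ` S \<and> edge_adjacent u v}\<^sup>*"
    if "(c, d) \<in> {(u, v). u \<in> S \<and> v \<in> S \<and> edge_adjacent u v}\<^sup>*" for c d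
    using that
  proof (induction rule: rtrancl_induct)
    case (step y z)
    then have "(f y, f z) \<in> {(u, v). u \<in> f ` S \<and> v \<in> f ` S \<and> edge_adjacent u v}"
      using f by auto
    then show ?case using step by (meson rtrancl.rtrancl_into_rtrancl)
  qed auto
  then show ?thesis using S by (auto simp: edge_connected_def)
qed

text \<open>A maximal nonempty connected proper subset \<open>T\<close> has an edge leading out of
  it; adding the far end \<open>v\<close> keeps it connected, so by maximality
  \<open>insert v T\<close> is all of \<open>S\<close>, and \<open>v\<close> can be removed.\<close>

lemma edge_connected_removable:
  assumes S: "finite S" "edge_connected S" "2 \<le> card S"
  obtains p t where "p \<in> S" "t \<in> S - {p}" "edge_adjacent t p" "edge_connected (S - {p})"
proof -
  let ?X = "{T. T \<subset> S \<and> T \<noteq> {} \<and> edge_connected T}"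
  obtain c where c: "c \<in> S" using S(3) by (cases "S = {}") auto
  have "S \<noteq> {c}" using S by auto
  then have "{c} \<in> ?X" using c edge_connected_singleton by auto
  then have ne: "?X \<noteq> {}" by blast
  have "finite ?X" using S by (auto intro: finite_subset[of _ "Pow S"])
  from finite_has_maximal[OF this ne] obtain T
    where T: "T \<in> ?X" and max: "\<forall>T'\<in>?X. T \<subseteq> T' \<longrightarrow> T = T'" by (rule bexE)
  from T have "T \<subset> S" "T \<noteq> {}" by blast+
  then obtain u v where uv: "u \<in> S" "u \<in> T" "v \<in> S" "v \<notin> T" "edge_adjacent u v"
    using edge_connected_exit[OF S(2), of _ T] by blast
  have conn: "edge_connected T" "edge_connected (insert v T)"
    using T edge_connected_insert uv(2,5) by auto
  have "insert v T = S"
  proof (rule ccontr)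
    assume "insert v T \<noteq> S"
    then have "insert v T \<in> ?X" using conn uv \<open>T \<subset> S\<close> by blast
    then show False using max uv by blast
  qed
  then have "S - {v} = T" using uv by auto
  then show ?thesis using that[of v u] uv conn by auto
qed

text \<open>A chain leaving the half plane of columns up to \<open>j\<close> does so through a
  horizontal edge between the columns \<open>j\<close> and \<open>j + 1\<close>.\<close>

lemma edge_connected_gap:
  assumes "edge_connected S" "(x, y) \<in> S" "(x', y') \<in> S" "x \<le> j" "j < x'"
  obtains i where "(j, i) \<in> S" "(j + 1, i) \<in> S"
proof -
  obtain u v where uv: "u \<in> S" "fst u \<le> j" "v \<in> S" "\<not> fst v \<le> j" "edge_adjacent u v"
  proof (rule edge_connected_exit[OF assms(1,2) _ assms(3), of "{u. fst u \<le> j}"])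
    show "(x, y) \<in> {u. fst u \<le> j}" "(x', y') \<notin> {u. fst u \<le> j}" using assms by auto
  qed auto
  then have "fst u = j" "fst v = j + 1" "snd u = snd v"
    by (auto simp: edge_adjacent_def)
  then show ?thesis using uv that by (metis prod.collapse)
qed

section \<open>Bounding boxes\<close>

definition spans :: "cell set \<Rightarrow> int \<Rightarrow> int \<Rightarrow> int \<Rightarrow> int \<Rightarrow> bool" where
  "spans S a b c d \<longleftrightarrow> finite S \<and> S \<subseteq> {a..b} \<times> {c..d} \<and> a \<in> fst ` S \<and> b \<in> fst ` S \<and> c \<in> snd ` S \<and> d \<in> snd ` S"

lemma spans_exists:
  assumes "finite S" "S \<noteq> {}"
  obtains a b c d where "spans S a b c d"
proof
  have "(x, y) \<in> {Min (fst ` S)..Max (fst ` S)} \<times> {Min (snd ` S)..Max (snd ` S)}" if "(x, y) \<in> S" for x y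
  proof -
    have "x \<in> fst ` S" "y \<in> snd ` S" using that by force+
    then show ?thesis using assms by simp
  qed
  then show "spans S (Min (fst ` S)) (Max (fst ` S)) (Min (snd ` S)) (Max (snd ` S))"
    unfolding spans_def using assms by (auto simp del: image_iff)
qed

lemma spans_Min_Max:
  assumes "spans S a b c d"
  shows "Min (fst ` S) = a" "Max (fst ` S) = b" "Min (snd ` S) = c" "Max (snd ` S) = d"
  using assms unfolding spans_def by (auto intro!: Max_eqI Min_eqI)

lemma spans_dims:
  assumes "spans S a b c d"
  shows "width S = b - a" "height S = d - c" "a \<le> b" "c \<le> d"
proof -
  show "width S = b - a" "height S = d - c" by (simp_all add: width_def height_def spans_Min_Max[OF assms])
  show "a \<le> b" "c \<le> d" using assms by (auto simp: spans_def)
qed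

lemma spans_unique:
  assumes "spans S a b c d" "spans S a' b' c' d'"
  shows "a = a'" "b = b'" "c = c'" "d = d'"
  using spans_Min_Max[OF assms(1)] spans_Min_Max[OF assms(2)] by simp_all

lemma spans_swap: "spans S a b c d \<Longrightarrow> spans (prod.swap ` S) c d a b"
  by (auto simp: spans_def image_image)

lemma spans_negx: "spans S a b c d \<Longrightarrow> spans (negx ` S) (- b) (- a) c d"
  by (auto simp: spans_def negx_def image_image)

lemma spans_fst: "edge_connected S \<Longrightarrow> spans S a b c d \<Longrightarrow> fst ` S = {a..b}"
proof (intro equalityI subsetI)
  assume S: "edge_connected S" "spans S a b c d"
  fix j assume j: "j \<in> {a..b}"
  show "j \<in> fst ` S"
  proof (cases "j = b")
    case True
    then show ?thesis using S by (auto simp: spans_def)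
  next
    case False
    obtain y y' where "(a, y) \<in> S" "(b, y') \<in> S" using S(2) by (auto simp: spans_def)
    then obtain i where "(j, i) \<in> S" using edge_connected_gap[OF S(1), of a y b y' j] j False by auto
    then show ?thesis by force
  qed
qed (auto simp: spans_def)

lemma edge_adjacent_swap: "edge_adjacent c d \<Longrightarrow> edge_adjacent (prod.swap c) (prod.swap d)"
  by (auto simp: edge_adjacent_def)

lemma edge_adjacent_negx: "edge_adjacent c d \<Longrightarrow> edge_adjacent (negx c) (negx d)"
  by (auto simp: edge_adjacent_def negx_def)

lemma spans_snd: 
  assumes "edge_connected S" "spans S a b c d" 
  shows "snd ` S = {c..d}"
proof -
  have "fst ` prod.swap ` S = {c..d}"
    using assms spans_swap edge_adjacent_swap by (intro spans_fst edge_connected_image) auto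
  then show ?thesis by (simp add: image_image)
qed

section \<open>Growth of the box and the area bound\<close>

lemma dims_insert_vertical:
  assumes "finite S" "(x, y) \<in> S" "\<bar>s\<bar> \<le> 1"
  shows "width (insert (x, y + s) S) = width S" "height (insert (x, y + s) S) \<le> height S + 1"
proof -
  have x: "x \<in> fst ` S" and y: "y \<in> snd ` S" using assms by force+
  show "width (insert (x, y + s) S) = width S"
    using x by (simp add: width_def insert_absorb)
  have ne: "S \<noteq> {}" using assms by auto
  have "Min (snd ` S) \<le> y" "y \<le> Max (snd ` S)" using y assms(1) by auto
  moreover have "Max (snd ` insert (x, y + s) S) = max (y + s) (Max (snd ` S))"
    "Min (snd ` insert (x, y + s) S) = min (y + s) (Min (snd ` S))"
    using assms(1) ne by simp_all
  ultimately show "height (insert (x, y + s) S) \<le> height S + 1"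
    using assms(3) unfolding height_def by linarith
qed

lemma dims_insert_horizontal:
  assumes "finite S" "(x, y) \<in> S" "\<bar>s\<bar> \<le> 1"
  shows "height (insert (x + s, y) S) = height S" "width (insert (x + s, y) S) \<le> width S + 1"
proof -
  have "(y, x) \<in> prod.swap ` S" using assms(2) by force
  from dims_insert_vertical[OF _ this assms(3)]
  show "height (insert (x + s, y) S) = height S" "width (insert (x + s, y) S) \<le> width S + 1"
    using assms(1) width_swap[of "insert (x + s, y) S"] height_swap[of "insert (x + s, y) S"]
    by (simp_all add: width_swap height_swap)
qed

text \<open>The numbers \<open>h\<close> and \<open>v\<close> count the horizontal and vertical
  edges along which cells were attached. A horizontal attachment gains at most half the height,
  hence at most \<open>v / 2\<close>, which is the increase of \<open>h * v / 2\<close> when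
  \<open>h\<close> grows by one; the other direction is symmetric.\<close>

lemma corner_area_bound:
  assumes "finite S" "S \<noteq> {}" "edge_connected S"
  obtains h v :: nat where "h + v + 1 = card S" "width S \<le> int h" "height S \<le> int v" "corner_area S \<le> real (h * v) / 2"
  using assms
proof (induction "card S" arbitrary: S thesis)
  case 0
  then show ?case by simp
next
  case (Suc n)
  show ?case
  proof (cases "n = 0")
    case True
    then obtain c where c: "S = {c}" using Suc.hyps(2) card_1_singletonE by (metis One_nat_def)
    show ?thesis using Suc.prems(1)[of 0 0] by (simp add: c width_def height_def corner_area_def)
  next
    case False
    obtain p t where rem: "p \<in> S" "t \<in> S - {p}" "edge_adjacent t p" "edge_connected (S - {p})"
    proof (rule edge_connected_removable[of S])
      show "2 \<le> card S" using Suc.hyps(2) False by simp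
    qed (use Suc.prems in auto)
    define T where "T = S - {p}"
    have T: "finite T" "S = insert p T" "t \<in> T" "n = card T" "T \<noteq> {}" "edge_connected T"
      using rem Suc by (auto simp: T_def)
    obtain h v where hv: "h + v + 1 = card T" "width T \<le> int h" "height T \<le> int v" "corner_area T \<le> real (h * v) / 2"
      using Suc.hyps(1)[OF T(4)] T by blast
    obtain x y where t: "t = (x, y)" by fastforce
    from rem(3) show ?thesis unfolding t
    proof (cases rule: edge_adjacent_cases)
      case (1 s)
      have "corner_area S \<le> corner_area T + real_of_int (height T) / 2"
        using corner_area_insert_horizontal[of T x y s] T 1 t by simp
      also have "\<dots> \<le> real (h * v) / 2 + real v / 2" using hv by simp
      finally have "corner_area S \<le> real ((h + 1) * v) / 2" by (simp add: field_simps)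
      moreover have "height S = height T" "width S \<le> width T + 1"
        using dims_insert_horizontal[of T x y s] T 1 t by auto
      ultimately show ?thesis
        using Suc.prems(1)[of "h + 1" v] hv T(4) Suc.hyps(2) by simp
    next
      case (2 s)
      have "corner_area S \<le> corner_area T + real_of_int (width T) / 2"
        using corner_area_insert_vertical[of T x y s] T 2 t by simp
      also have "\<dots> \<le> real (h * v) / 2 + real h / 2" using hv by simp
      finally have "corner_area S \<le> real (h * (v + 1)) / 2" by (simp add: field_simps)
      moreover have "width S = width T" "height S \<le> height T + 1"
        using dims_insert_vertical[of T x y s] T 2 t by auto
      ultimately show ?thesis
        using Suc.prems(1)[of h "v + 1"] hv T(4) Suc.hyps(2) by simp
    qed
  qed
qed

text \<open>Equality in both estimates relative to the set's own box. The proportions of the box are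
  left free, because the removal of cells need not preserve a balance between its sides.\<close>

definition extremal :: "cell set \<Rightarrow> bool" where
  "extremal S \<longleftrightarrow> finite S \<and> S \<noteq> {} \<and> edge_connected S \<and> int (card S) = width S + height S + 1 \<and>
     corner_area S = of_int (width S * height S) / 2"

lemma card_ge:
  assumes "finite S" "S \<noteq> {}" "edge_connected S"
  shows "width S + height S + 1 \<le> int (card S)"
proof -
  obtain h v where hv: "h + v + 1 = card S" "width S \<le> int h" "height S \<le> int v"
    using corner_area_bound[OF assms] .
  then show ?thesis by linarith
qed

text \<open>With the least possible number of cells for the box, the edge counts \<open>h\<close>
  and \<open>v\<close> must equal its side lengths.\<close>

lemma corner_area_le:
  assumes "finite S" "S \<noteq> {}" "edge_connected S" "int (card S) = width S + height S + 1"
  shows "corner_area S \<le> of_int (width S * height S) / 2"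
proof -
  obtain h v where hv: "h + v + 1 = card S" "width S \<le> int h" "height S \<le> int v" "corner_area S \<le> real (h * v) / 2"
    using corner_area_bound[OF assms(1-3)] .
  then have "width S = int h" "height S = int v" using assms(4) by linarith+
  then show ?thesis using hv by simp
qed

lemma extremal_swap:
  assumes "extremal S" shows "extremal (prod.swap ` S)"
proof -
  have "card (prod.swap ` S) = card S" by (intro card_image) auto
  then show ?thesis
    using assms unfolding extremal_def
    by (auto simp: width_swap height_swap corner_area_swap intro!: edge_connected_image edge_adjacent_swap)
qed

lemma extremal_negx:
  assumes "extremal S" shows "extremal (negx ` S)"
proof -
  obtain a b c d where S: "spans S a b c d" using assms spans_exists by (metis extremal_def)
  have "card (negx ` S) = card S" by (intro card_image) (auto simp: inj_on_def negx_def prod_eq_iff)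
  then show ?thesis
    using assms spans_dims[OF S] spans_dims[OF spans_negx[OF S]] unfolding extremal_def
    by (auto simp: corner_area_negx intro!: edge_connected_image edge_adjacent_negx)
qed

section \<open>Extremal sets contain a full row or column\<close>

lemma corner_area_mono:
  assumes "finite V" "corner ` S \<subseteq> convex hull (corner ` V)" "finite S"
  shows "corner_area S \<le> corner_area V"
  unfolding corner_area_def using assms
  by (intro measure_mono_fmeasurable lmeasurable_compact compact_hull_corner fmeasurableD hull_minimal)
    auto

lemma corner_between_horizontal:
  assumes "(i, y) \<in> V" "(j, y) \<in> V" "i \<le> k" "k \<le> j"
  shows "corner (k, y) \<in> convex hull (corner ` V)"
proof (cases "i = j")
  case True
  then show ?thesis using assms by (intro hull_inc imageI) auto
next
  case False
  define t :: real where "t = of_int (k - i) / of_int (j - i)"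
  have t: "0 \<le> t" "t \<le> 1" "t * (of_int j - of_int i) = of_int k - of_int i"
    using assms False by (auto simp: t_def field_simps)
  have "(1 - t) *\<^sub>R corner (i, y) + t *\<^sub>R corner (j, y) \<in> convex hull (corner ` V)"
    using t assms by (intro convexD convex_convex_hull hull_inc imageI) auto
  moreover have "(1 - t) *\<^sub>R corner (i, y) + t *\<^sub>R corner (j, y) = corner (k, y)"
    using t by (simp add: algebra_simps)
  ultimately show ?thesis by simp
qed

lemma corner_between_vertical:
  assumes "(x, i) \<in> V" "(x, j) \<in> V" "i \<le> k" "k \<le> j"
  shows "corner (x, k) \<in> convex hull (corner ` V)"
proof -
  have "corner (k, x) \<in> convex hull (corner ` prod.swap ` V)"
    using assms by (intro corner_between_horizontal[of i _ _ j]) force+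
  then show ?thesis unfolding corner_swap hull_swap by (auto simp: image_iff)
qed

text \<open>The box of the hook has sides \<open>w + 1\<close> and \<open>h + 1\<close>, so the term
  \<open>- 1\<close> is the deficit against half the box. The hull is enclosed by half planes and
  its slices are integrated.\<close>

lemma hook_corner_area_origin:
  fixes w h :: int
  assumes "1 \<le> w" "1 \<le> h"
  shows "corner_area {(0, 0), (1, 0), (1, h), (w + 1, h), (w + 1, h + 1)} \<le> of_int ((w + 1) * (h + 1) - 1) / 2"
proof -
  let ?V = "{(0, 0), (1, 0), (1, h), (w + 1, h), (w + 1, h + 1)} :: cell set"
  define W H :: real where "W = of_int w" and "H = of_int h"
  have WH: "1 \<le> W" "1 \<le> H" using assms by (auto simp: W_def H_def)
  then have WH1: "1 \<le> W * H" using mult_mono[of 1 W 1 H] by simp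
  let ?C = "convex hull (corner ` ?V)"
  \<comment> \<open>Besides three sides of the box, these are the lines through
    \<open>(1, 0)\<close> and \<open>(W + 1, H)\<close>, through \<open>(0, 0)\<close> and
    \<open>(1, H)\<close>, and through \<open>(1, H)\<close> and
    \<open>(W + 1, H + 1)\<close>.\<close>
  let ?Q = "{z. inner (-1, 0) z \<le> 0} \<inter> {z. inner (1, 0) z \<le> W + 1} \<inter> {z. inner (0, -1) z \<le> 0}
    \<inter> {z. inner (H, - W) z \<le> H} \<inter> {z. inner (- H, 1) z \<le> 0} \<inter> {z. inner (-1, W) z \<le> W * H - 1}
    :: (real \<times> real) set"
  have "?C \<subseteq> ?Q"
  proof (intro hull_minimal convex_Int convex_halfspace_le)
    show "corner ` ?V \<subseteq> ?Q"
      using WH WH1 by (auto simp flip: W_def H_def simp: algebra_simps)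
  qed
  then have Q: "0 \<le> x" "x \<le> W + 1" "0 \<le> y" "H * x - H \<le> W * y" "y \<le> H * x" "W * y \<le> W * H - 1 + x"
    if "(x, y) \<in> ?C" for x y
    using that by auto
  have C: "compact ?C" by (intro compact_hull_corner) simp
  have fstC: "fst ` ?C \<subseteq> {0..W + 1}" using Q by force
  \<comment> \<open>Upper boundary minus lower boundary; both bend at \<open>x = 1\<close>.\<close>
  define f where "f x = (if x \<le> 1 then H * x else H + (x - 1) / W - H * (x - 1) / W)" for x
  have le: "measure lborel (Pair x -` ?C) \<le> f x" if x: "x \<in> {0..W + 1}" for x
  proof (cases "x \<le> 1")
    case True
    have "Pair x -` ?C \<subseteq> {0..H * x}" using Q by auto
    then have "measure lborel (Pair x -` ?C) \<le> H * x - 0"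
      using x WH by (intro measure_slice_le C) auto
    then show ?thesis using True by (simp add: f_def)
  next
    case False
    have "Pair x -` ?C \<subseteq> {H * (x - 1) / W..H + (x - 1) / W}"
      using Q[of x] WH by (auto simp: field_simps)
    moreover have "H * (x - 1) / W \<le> H + (x - 1) / W"
    proof -
      have "H * (x - 1) \<le> H * W" using x WH by (intro mult_left_mono) auto
      then have "H * (x - 1) / W \<le> H" using WH by (simp add: field_simps)
      moreover have "0 \<le> (x - 1) / W" using False WH by simp
      ultimately show ?thesis by linarith
    qed
    ultimately have "measure lborel (Pair x -` ?C) \<le> H + (x - 1) / W - H * (x - 1) / W"
      by (intro measure_slice_le C)
    then show ?thesis using False by (simp add: f_def)
  qed
  have int: "(f has_integral (W * H + W + H) / 2) {0..W + 1}"
  proof -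
    have "((\<lambda>x. 0 + H * x) has_integral 0 * (1 - 0) + H * (1\<^sup>2 - 0\<^sup>2) / 2) {0..1}"
      by (intro affine_has_integral) simp
    then have "((\<lambda>x. 0 + H * x) has_integral H / 2) {0..1}" by simp
    then have 1: "(f has_integral H / 2) {0..1}"
      by (rule has_integral_eq[rotated]) (simp add: f_def)
    let ?c = "H - 1 / W + H / W" and ?d = "1 / W - H / W"
    have "((\<lambda>x. ?c + ?d * x) has_integral
        ?c * (W + 1 - 1) + ?d * ((W + 1)\<^sup>2 - 1\<^sup>2) / 2) {1..W + 1}"
      using WH by (intro affine_has_integral) simp
    moreover have "?c * (W + 1 - 1) + ?d * ((W + 1)\<^sup>2 - 1\<^sup>2) / 2 = W * (H + 1) / 2"
      using WH by (simp add: field_simps power2_eq_square)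
    ultimately have "((\<lambda>x. ?c + ?d * x) has_integral W * (H + 1) / 2) {1..W + 1}"
      by (simp only:)
    then have 2: "(f has_integral W * (H + 1) / 2) {1..W + 1}"
    proof (rule has_integral_eq[rotated])
      fix x assume "x \<in> {1..W + 1}"
      then show "?c + ?d * x = f x" using WH by (auto simp: f_def field_simps)
    qed
    have "(f has_integral H / 2 + W * (H + 1) / 2) {0..W + 1}"
      using WH by (intro has_integral_combine[OF _ _ 1 2]) auto
    moreover have "H / 2 + W * (H + 1) / 2 = (W * H + W + H) / 2" by (simp add: field_simps)
    ultimately show ?thesis by simp
  qed
  have "corner_area ?V \<le> (W * H + W + H) / 2"
    unfolding corner_area_def by (rule has_integral_le[OF slice_has_integral[OF C fstC] int le])
  then show ?thesis by (simp add: W_def H_def algebra_simps)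
qed

lemma hook_corner_area:
  fixes x x' y y' :: int
  assumes "x < x'" "y < y'"
  shows "corner_area {(x - 1, y), (x, y), (x, y'), (x', y'), (x', y' + 1)} \<le>
    of_int ((x' - x + 1) * (y' - y + 1) - 1) / 2"
proof -
  have "{(x - 1, y), (x, y), (x, y'), (x', y'), (x', y' + 1)} =
    (+) (x - 1, y) ` {(0, 0), (1, 0), (1, y' - y), (x' - x + 1, y' - y), (x' - x + 1, y' - y + 1)}"
    by simp
  then show ?thesis
    using hook_corner_area_origin[of "x' - x" "y' - y"] assms by (simp only: corner_area_translate)
qed

text \<open>A full column at \<open>x\<close> with a left arm at height \<open>y\<close> and a right
  arm at height \<open>y'\<close>. The parts are disjoint. For \<open>x = a\<close> or
  \<open>x = b\<close> an arm is empty and different heights give the same set, so the bent crosses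
  counted later have interior columns.\<close>

definition cross :: "int \<Rightarrow> int \<Rightarrow> int \<Rightarrow> int \<Rightarrow> int \<Rightarrow> int \<Rightarrow> int \<Rightarrow> cell set" where
  "cross a b c d x y y' = {x} \<times> {c..d} \<union> {a..<x} \<times> {y} \<union> {x<..b} \<times> {y'}"

lemma mem_cross: "(i, j) \<in> cross a b c d x y y' \<longleftrightarrow>
    i = x \<and> c \<le> j \<and> j \<le> d \<or> a \<le> i \<and> i < x \<and> j = y \<or> x < i \<and> i \<le> b \<and> j = y'"
  by (auto simp: cross_def)

text \<open>
  The deficit \<open>1 / 2\<close> of the hook survives the insertion of the ends of the remaining arms, since
  each insertion adds at most half the length of the arm times the perpendicular extent of the hull.
\<close>

lemma corner_area_bent_cross_less:
  assumes x: "a < x" "x < x2" "x2 \<le> b" and y: "c \<le> y" "y < d"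
  shows "corner_area (insert (x2, d + 1) (cross a b c d x y d)) < of_int ((b - a) * (d + 1 - c)) / 2"
proof -
  define V0 where "V0 = {(x - 1, y), (x, y), (x, d), (x2, d), (x2, d + 1)}"
  define V1 where "V1 = insert (a, y) V0"
  define V2 where "V2 = insert (x, c) V1"
  define V3 where "V3 = insert (b, d) V2"
  have fin: "finite V0" "finite V1" "finite V2" "finite V3"
    by (simp_all add: V0_def V1_def V2_def V3_def)
  have V0: "spans V0 (x - 1) x2 y (d + 1)" using x y by (auto simp: spans_def V0_def)
  have V1: "spans V1 a x2 y (d + 1)" using x y V0 by (auto simp: spans_def V1_def V0_def)
  have V2: "spans V2 a x2 c (d + 1)" using x y V1 by (auto simp: spans_def V2_def V1_def V0_def)
  have "corner_area V0 \<le> of_int ((x2 - x + 1) * (d - y + 1) - 1) / 2"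
    unfolding V0_def using x y by (intro hook_corner_area) auto
  moreover have "corner_area V1 \<le> corner_area V0 + of_int ((x - 1 - a) * (d + 1 - y)) / 2"
    using corner_area_insert_horizontal[of V0 "x - 1" y "a - (x - 1)"] fin x spans_dims[OF V0]
    by (simp add: V1_def V0_def)
  moreover have "corner_area V2 \<le> corner_area V1 + of_int ((y - c) * (x2 - a)) / 2"
    using corner_area_insert_vertical[of V1 x y "c - y"] fin y spans_dims[OF V1]
    by (simp add: V2_def V1_def V0_def)
  moreover have "corner_area V3 \<le> corner_area V2 + of_int ((b - x2) * (d + 1 - c)) / 2"
    using corner_area_insert_horizontal[of V2 x2 d "b - x2"] fin x spans_dims[OF V2]
    by (simp add: V3_def V2_def V1_def V0_def)
  moreover have "c3 \<le> (p + q + r + s) / 2"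
    if "c0 \<le> p / 2" "c1 \<le> c0 + q / 2" "c2 \<le> c1 + r / 2" "c3 \<le> c2 + s / 2"
    for c0 c1 c2 c3 p q r s :: real
    using that by (simp add: field_simps)
  ultimately have "corner_area V3 \<le> (of_int ((x2 - x + 1) * (d - y + 1) - 1) + of_int ((x - 1 - a) * (d + 1 - y))
      + of_int ((y - c) * (x2 - a)) + of_int ((b - x2) * (d + 1 - c))) / 2"
    by blast
  \<comment> \<open>The rectangles of the three insertions fill up the box of the hook to the whole
    box, so the sum telescopes and just the deficit of the hook remains.\<close>
  also have "\<dots> = of_int ((b - a) * (d + 1 - c) - 1) / 2"
    by (simp add: algebra_simps)
  finally have V3: "corner_area V3 \<le> of_int ((b - a) * (d + 1 - c) - 1) / 2" .
  \<comment> \<open>The column and the arms lie on segments between points of \<open>V3\<close>, so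
    the remaining cells do not enlarge the hull.\<close>
  have "corner_area (insert (x2, d + 1) (cross a b c d x y d)) \<le> corner_area V3"
  proof (rule corner_area_mono)
    show "corner ` insert (x2, d + 1) (cross a b c d x y d) \<subseteq> convex hull (corner ` V3)"
    proof
      fix z assume "z \<in> corner ` insert (x2, d + 1) (cross a b c d x y d)"
      then obtain e where "z = corner e" "e \<in> insert (x2, d + 1) (cross a b c d x y d)" by blast
      then obtain i j where ij: "z = corner (i, j)" "(i, j) \<in> insert (x2, d + 1) (cross a b c d x y d)"
        by (cases e) blast
      then consider "i = x2" "j = d + 1" | "i = x" "c \<le> j" "j \<le> d" | "a \<le> i" "i < x" "j = y" | "x < i" "i \<le> b" "j = d"
        by (auto simp: mem_cross)
      then show "z \<in> convex hull (corner ` V3)"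
      proof cases
        case 1
        then show ?thesis using ij by (intro hull_inc) (auto simp: V3_def V2_def V1_def V0_def)
      next
        case 2
        then show ?thesis using ij corner_between_vertical[of x c V3 d j] by (simp add: V3_def V2_def V1_def V0_def)
      next
        case 3
        then show ?thesis using ij corner_between_horizontal[of a y V3 x i] by (simp add: V3_def V2_def V1_def V0_def)
      next
        case 4
        then show ?thesis using ij corner_between_horizontal[of x d V3 b i] by (simp add: V3_def V2_def V1_def V0_def)
      qed
    qed
  qed (use fin in \<open>auto simp: cross_def\<close>)
  then show ?thesis using V3 by (simp add: field_simps)
qed

text \<open>The full column leaves exactly one cell for each other column. Connectivity demands a
  horizontal edge across each gap between neighbouring columns, so consecutive cells on one side
  have the same height.\<close>

lemma cross_of_full_col:
  assumes T: "edge_connected T" "spans T a b c d" "int (card T) = (b - a) + (d - c) + 1"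
    and col: "\<And>j. c \<le> j \<Longrightarrow> j \<le> d \<Longrightarrow> (x, j) \<in> T"
  obtains y y' where "y \<in> {c..d}" "y' \<in> {c..d}" "T = cross a b c d x y y'"
proof -
  have fin: "finite T" and box: "T \<subseteq> {a..b} \<times> {c..d}" using T(2) by (auto simp: spans_def)
  have cd: "c \<le> d" using spans_dims[OF T(2)] by simp
  then have x: "a \<le> x" "x \<le> b" using col[of c] box by auto
  obtain u v where u: "(a, u) \<in> T" and v: "(b, v) \<in> T" using T(2) by (auto simp: spans_def)
  have "\<forall>j\<in>{a..<x}. \<exists>i. (j, i) \<in> T \<and> (j + 1, i) \<in> T"
    using edge_connected_gap[OF T(1) u col[OF order_refl cd]] by (metis atLeastLessThan_iff)
  then obtain g where g: "\<And>j. j \<in> {a..<x} \<Longrightarrow> (j, g j) \<in> T \<and> (j + 1, g j) \<in> T" by metis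
  have "\<forall>j\<in>{x<..b}. \<exists>i. (j - 1, i) \<in> T \<and> (j, i) \<in> T"
  proof
    fix j assume "j \<in> {x<..b}"
    then show "\<exists>i. (j - 1, i) \<in> T \<and> (j, i) \<in> T"
      using edge_connected_gap[OF T(1) col[OF order_refl cd] v, of "j - 1"] by auto
  qed
  then obtain g' where g': "\<And>j. j \<in> {x<..b} \<Longrightarrow> (j - 1, g' j) \<in> T \<and> (j, g' j) \<in> T" by metis
  \<comment> \<open>In each other column, the cell on the edge leading towards the column
    \<open>x\<close>. These cells and the column already exhaust the cardinality of
    \<open>T\<close>.\<close>
  define U where "U = {x} \<times> {c..d} \<union> (\<lambda>j. (j, g j)) ` {a..<x} \<union> (\<lambda>j. (j, g' j)) ` {x<..b}"
  have "card U = card ({x} \<times> {c..d}) + card ((\<lambda>j. (j, g j)) ` {a..<x}) + card ((\<lambda>j. (j, g' j)) ` {x<..b})"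
    unfolding U_def by (subst card_Un_disjoint, auto)+
  also have "\<dots> = nat (d - c + 1) + nat (x - a) + nat (b - x)"
    by (simp add: card_cartesian_product card_image inj_on_def)
  finally have "card U = card T" using T(3) x cd by linarith
  moreover have "U \<subseteq> T" using col g g' by (auto simp: U_def)
  ultimately have U: "T = U" using fin by (metis card_subset_eq)
  have gstep: "g j = g (j + 1)" if "a \<le> j" "j + 1 < x" for j
    using g[of j] that unfolding U by (auto simp: U_def)
  have g'step: "g' j = g' (j - 1)" if "j \<le> b" "x < j - 1" for j
    using g'[of j] that unfolding U by (auto simp: U_def)
  have gc: "a \<le> x - 1 - int k \<longrightarrow> g (x - 1 - int k) = g (x - 1)" for k
    by (induction k) (use gstep in \<open>force simp: algebra_simps\<close>)+
  have g'c: "x + 1 + int k \<le> b \<longrightarrow> g' (x + 1 + int k) = g' (x + 1)" for k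
    by (induction k) (use g'step in \<open>force simp: algebra_simps\<close>)+
  have geq: "g j = g (x - 1)" if "j \<in> {a..<x}" for j
    using gc[of "nat (x - 1 - j)"] that by simp
  have g'eq: "g' j = g' (x + 1)" if "j \<in> {x<..b}" for j
    using g'c[of "nat (j - x - 1)"] that by simp
  \<comment> \<open>An empty arm gets the height \<open>c\<close>, an arbitrary value inside the
    box.\<close>
  define y where "y = (if a < x then g (x - 1) else c)"
  define y' where "y' = (if x < b then g' (x + 1) else c)"
  have "g j = y" if "j \<in> {a..<x}" for j using geq[OF that] that by (simp add: y_def)
  then have "(\<lambda>j. (j, g j)) ` {a..<x} = (\<lambda>j. (j, y)) ` {a..<x}" by (intro image_cong) auto
  moreover have "g' j = y'" if "j \<in> {x<..b}" for j using g'eq[OF that] that by (simp add: y'_def)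
  then have "(\<lambda>j. (j, g' j)) ` {x<..b} = (\<lambda>j. (j, y')) ` {x<..b}" by (intro image_cong) auto
  moreover have "(\<lambda>j. (j, i)) ` A = A \<times> {i}" for i :: int and A :: "int set"
    by auto
  ultimately have "T = cross a b c d x y y'" by (simp add: U U_def cross_def)
  moreover have "y \<in> {c..d}" "y' \<in> {c..d}"
    using g[of "x - 1"] g'[of "x + 1"] box cd by (auto simp: y_def y'_def)
  ultimately show ?thesis using that by blast
qed

section \<open>Propagation of full lines\<close>

definition full_line :: "cell set \<Rightarrow> bool" where
  "full_line S \<longleftrightarrow> (\<exists>x. \<forall>y\<in>snd ` S. (x, y) \<in> S) \<or> (\<exists>y. \<forall>x\<in>fst ` S. (x, y) \<in> S)"

lemma full_line_swap: "full_line (prod.swap ` S) \<longleftrightarrow> full_line S"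
proof -
  have "(i, j) \<in> prod.swap ` S \<longleftrightarrow> (j, i) \<in> S" for i j by force
  then show ?thesis by (auto simp: full_line_def image_image)
qed

lemma full_line_negx: "full_line (negx ` S) \<longleftrightarrow> full_line S"
proof -
  have mem: "(i, j) \<in> negx ` S \<longleftrightarrow> (- i, j) \<in> S" for i j by (force simp: negx_def)
  have "(\<exists>x. \<forall>y\<in>snd ` S. (- x, y) \<in> S) \<longleftrightarrow> (\<exists>x. \<forall>y\<in>snd ` S. (x, y) \<in> S)"
    by (metis minus_minus)
  then show ?thesis by (simp add: full_line_def mem image_image) (simp add: negx_def)
qed

text \<open>For \<open>x' = x\<close> the new cell prolongs the column. Otherwise it sits on the
  right arm, which must then run along the top row \<open>d\<close>. If the left arm is empty or
  also at height \<open>d\<close>, that row is full; the remaining configuration is the bent cross,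
  whose area is too small.\<close>

lemma full_line_step_col:
  assumes S: "extremal S" and T: "extremal T" "spans T a b c d"
    and ins: "S = insert (x', d + 1) T" "(x', d) \<in> T"
    and col: "\<And>j. c \<le> j \<Longrightarrow> j \<le> d \<Longrightarrow> (x, j) \<in> T" and le: "x \<le> x'"
  shows "full_line S"
proof -
  have box: "T \<subseteq> {a..b} \<times> {c..d}" using T(2) by (simp add: spans_def)
  have spansS: "spans S a b c (d + 1)" using T(2) box ins by (auto simp: spans_def)
  obtain y y' where y: "y \<in> {c..d}" "y' \<in> {c..d}" and Teq: "T = cross a b c d x y y'"
    using cross_of_full_col[of T a b c d x] T col spans_dims[OF T(2)] by (auto simp: extremal_def)
  have x: "a \<le> x" "x \<le> b" "x' \<le> b" using col[of c] y ins box by auto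
  show ?thesis
  proof (cases "x = x'")
    case True
    have "(x, j) \<in> S" if "j \<in> snd ` S" for j
    proof (cases "j = d + 1")
      case False
      then have "c \<le> j \<and> j \<le> d" using that spansS by (auto simp: spans_def)
      then show ?thesis using col ins by auto
    qed (simp add: ins True)
    then show ?thesis by (auto simp: full_line_def)
  next
    case False
    then have y': "y' = d" using ins(2) le unfolding Teq mem_cross by auto
    show ?thesis
    proof (cases "x = a \<or> y = d")
      case True
      have "(i, d) \<in> S" if "i \<in> fst ` S" for i
      proof -
        have "a \<le> i" "i \<le> b" using that spansS by (auto simp: spans_def)
        then show ?thesis using True y by (auto simp: ins Teq mem_cross y')
      qed
      then show ?thesis unfolding full_line_def by blast
    next
      case 2: False
      then have "corner_area S < of_int ((b - a) * (d + 1 - c)) / 2"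
        unfolding ins Teq y' using x y le False by (intro corner_area_bent_cross_less) auto
      moreover have "corner_area S = of_int ((b - a) * (d + 1 - c)) / 2"
        using S spans_dims[OF spansS] by (simp add: extremal_def)
      ultimately show ?thesis by simp
    qed
  qed
qed

text \<open>A full row survives because the new cell lies in an old column. For a full column the
  new cell must top the box, and reflection brings it to the right of the column or onto it.\<close>

lemma full_line_step:
  assumes S: "extremal S" and T: "extremal T" "full_line T"
    and ins: "S = insert (x', y' + 1) T" "(x', y') \<in> T" "(x', y' + 1) \<notin> T"
  shows "full_line S"
proof -
  obtain a b c d where sp: "spans T a b c d" using spans_exists T by (metis extremal_def)
  have box: "T \<subseteq> {a..b} \<times> {c..d}" using sp by (simp add: spans_def)
  have conn: "edge_connected T" "finite T" using T by (auto simp: extremal_def)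
  have "card S = card T + 1" using ins conn by simp
  moreover have "width S = width T" using dims_insert_vertical[of T x' y' 1] ins conn by simp
  ultimately have h: "height S = height T + 1" using S T by (simp add: extremal_def)
  \<comment> \<open>The extra cell adds no column, so it has to add a row to keep the cell count
    tight.\<close>
  have "y' = d"
  proof (rule ccontr)
    assume "y' \<noteq> d"
    then have "spans S a b c d" using sp ins by (auto simp: spans_def)
    then show False using h spans_dims sp by force
  qed
  note ins = ins[unfolded this]
  from T(2) consider x where "\<forall>y\<in>snd ` T. (x, y) \<in> T" | y where "\<forall>x\<in>fst ` T. (x, y) \<in> T"
    by (auto simp: full_line_def)
  then show ?thesis
  proof cases
    case 1
    then have col: "(x, j) \<in> T" if "c \<le> j" "j \<le> d" for j
      using spans_snd[OF conn(1) sp] that by auto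
    show ?thesis
    proof (cases "x \<le> x'")
      case True
      then show ?thesis using full_line_step_col[OF S T(1) sp ins(1,2)] col by blast
    next
      case False
      have mem: "(i, j) \<in> negx ` T \<longleftrightarrow> (- i, j) \<in> T" for i j by (force simp: negx_def)
      have "full_line (negx ` S)"
      proof (rule full_line_step_col[OF extremal_negx[OF S] extremal_negx[OF T(1)] spans_negx[OF sp],
            where x = "- x" and x' = "- x'"])
        show "negx ` S = insert (- x', d + 1) (negx ` T)" by (simp add: ins negx_def)
      qed (use mem ins col False in auto)
      then show ?thesis by (simp add: full_line_negx)
    qed
  next
    case 2
    then have "\<forall>x\<in>fst ` S. (x, y) \<in> S" using ins by force
    then show ?thesis by (auto simp: full_line_def)
  qed
qed

text \<open>By \<open>card_ge\<close> the smaller set has a cell for every unit of its box, so the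
  removed cell must have enlarged the box by one along its edge. It contributed at most half the
  perpendicular extent to the area, which leaves the smaller set at its own maximum.\<close>

lemma extremal_remove:
  assumes S: "extremal S" "p \<in> S" "t \<in> S - {p}" "edge_adjacent t p" "edge_connected (S - {p})"
  shows "extremal (S - {p})"
proof -
  define T where "T = S - {p}"
  have T: "finite T" "T \<noteq> {}" "edge_connected T" "t \<in> T" "S = insert p T" "card S = card T + 1"
    using S card_Suc_Diff1[of S p] by (auto simp: T_def extremal_def)
  have lb: "width T + height T + 1 \<le> int (card T)" using card_ge T by blast
  obtain x y where t: "t = (x, y)" by fastforce
  have "int (card T) = width T + height T + 1 \<and> of_int (width T * height T) / 2 \<le> corner_area T"
    using S(4) unfolding t
  proof (cases rule: edge_adjacent_cases)
    case (1 s)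
    have "height S = height T" "width S \<le> width T + 1" 
      using dims_insert_horizontal[of T x y s] T 1 t by auto
    then have eq: "int (card T) = width T + height T + 1" and dim: "width S = width T + 1" "height S = height T"
      using lb T S(1) by (auto simp: extremal_def)
    have "corner_area S \<le> corner_area T + of_int (height T) / 2"
      using corner_area_insert_horizontal[of T x y s] T 1 t by simp
    moreover have "corner_area S = of_int ((width T + 1) * height T) / 2"
      using S(1) by (simp add: extremal_def dim)
    ultimately show ?thesis using eq by (simp add: field_simps)
  next
    case (2 s)
    have "width S = width T" "height S \<le> height T + 1" 
      using dims_insert_vertical[of T x y s] T 2 t by auto
    then have eq: "int (card T) = width T + height T + 1" and dim: "height S = height T + 1" "width S = width T"
      using lb T S(1) by (auto simp: extremal_def)
    have "corner_area S \<le> corner_area T + of_int (width T) / 2"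
      using corner_area_insert_vertical[of T x y s] T 2 t by simp
    moreover have "corner_area S = of_int (width T * (height T + 1)) / 2"
      using S(1) by (simp add: extremal_def dim)
    ultimately show ?thesis using eq by (simp add: field_simps)
  qed
  then show ?thesis
    using T(1-3) corner_area_le[OF T(1-3)] unfolding extremal_def T_def[symmetric] by linarith
qed

lemma extremal_full_line: "extremal S \<Longrightarrow> full_line S"
proof (induction "card S" arbitrary: S)
  case 0
  then show ?case by (auto simp: extremal_def)
next
  case (Suc n)
  have S: "finite S" "S \<noteq> {}" "edge_connected S" using Suc by (auto simp: extremal_def)
  show ?case
  proof (cases "n = 0")
    case True
    then obtain c where "S = {c}" using Suc.hyps(2) card_1_singletonE by (metis One_nat_def)
    then have "\<forall>y\<in>snd ` S. (fst c, y) \<in> S" by simp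
    then show ?thesis unfolding full_line_def by blast
  next
    case False
    then have "2 \<le> card S" using Suc.hyps(2) by simp
    then obtain p t where rem: "p \<in> S" "t \<in> S - {p}" "edge_adjacent t p" "edge_connected (S - {p})"
      using edge_connected_removable[OF S(1,3)] by metis
    define T where "T = S - {p}"
    have T: "extremal T" unfolding T_def using extremal_remove Suc.prems rem by blast
    have ST: "S = insert p T" "p \<notin> T" "t \<in> T" using rem by (auto simp: T_def)
    have "n = card T" using rem(1) S(1) Suc.hyps(2) by (simp add: T_def)
    then have fT: "full_line T" using Suc.hyps(1) T by blast
    obtain x y where t: "t = (x, y)" by fastforce
    \<comment> \<open>Both maps bring the last attachment into the upward direction:
      \<open>?f\<close> from the left, \<open>?g\<close> from below. For the right, transposition
      alone does it.\<close>
    let ?f = "\<lambda>A. prod.swap ` negx ` A" and ?g = "\<lambda>A. prod.swap ` negx ` prod.swap ` A"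
    have swap: "(i, j) \<in> prod.swap ` A \<longleftrightarrow> (j, i) \<in> A" for i j :: int and A by force
    have negx: "(i, j) \<in> negx ` A \<longleftrightarrow> (- i, j) \<in> A" for i j :: int and A by (force simp: negx_def)
    note ext = extremal_swap extremal_negx
    from rem(3) show ?thesis unfolding t
    proof (cases rule: edge_adjacent_cases)
      case (1 s)
      then consider "s = 1" | "s = - 1" by linarith
      then show ?thesis
      proof cases
        case s: 1
        have "full_line (prod.swap ` S)"
        proof (rule full_line_step)
          show "extremal (prod.swap ` S)" "extremal (prod.swap ` T)" by (intro ext Suc.prems T)+
          show "full_line (prod.swap ` T)" using fT by (simp only: full_line_swap full_line_negx)
          show "prod.swap ` S = insert (y, x + 1) (prod.swap ` T)"
            using 1 s by (simp add: ST(1) negx_def)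
          show "(y, x) \<in> prod.swap ` T" "(y, x + 1) \<notin> prod.swap ` T"
            using 1 s ST t by (simp_all add: swap)
        qed
        then show ?thesis by (simp only: full_line_swap full_line_negx)
      next
        case s: 2
        have "full_line (?f S)"
        proof (rule full_line_step)
          show "extremal (?f S)" "extremal (?f T)" by (intro ext Suc.prems T)+
          show "full_line (?f T)" using fT by (simp only: full_line_swap full_line_negx)
          show "?f S = insert (y, - x + 1) (?f T)"
            using 1 s by (simp add: ST(1) negx_def)
          show "(y, - x) \<in> ?f T" "(y, - x + 1) \<notin> ?f T"
            using 1 s ST t by (simp_all add: swap negx)
        qed
        then show ?thesis by (simp only: full_line_swap full_line_negx)
      qed
    next
      case (2 s)
      then consider "s = 1" | "s = - 1" by linarith
      then show ?thesis
      proof cases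
        case s: 1
        show ?thesis
        proof (rule full_line_step[OF Suc.prems T fT])
          show "S = insert (x, y + 1) T" using ST(1) 2 s by simp
          show "(x, y) \<in> T" "(x, y + 1) \<notin> T" using ST t 2 s by simp_all
        qed
      next
        case s: 2
        have "full_line (?g S)"
        proof (rule full_line_step)
          show "extremal (?g S)" "extremal (?g T)" by (intro ext Suc.prems T)+
          show "full_line (?g T)" using fT by (simp only: full_line_swap full_line_negx)
          show "?g S = insert (x, - y + 1) (?g T)"
            using 2 s by (simp add: ST(1) negx_def)
          show "(x, - y) \<in> ?g T" "(x, - y + 1) \<notin> ?g T"
            using 2 s ST t by (simp_all add: swap negx)
        qed
        then show ?thesis by (simp only: full_line_swap full_line_negx)
      qed
    qed
  qed
qed

section \<open>Crosses are extremal\<close>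

lemma edge_connected_Un:
  assumes "edge_connected A" "edge_connected B" "p \<in> A" "p \<in> B"
  shows "edge_connected (A \<union> B)"
proof (rule edge_connectedI)
  let ?R = "\<lambda>S. {(u, v). u \<in> S \<and> v \<in> S \<and> edge_adjacent u v}"
  have "(?R A)\<^sup>* \<subseteq> (?R (A \<union> B))\<^sup>*" "(?R B)\<^sup>* \<subseteq> (?R (A \<union> B))\<^sup>*"
    by (rule rtrancl_mono, blast)+
  then show "(q, p) \<in> (?R (A \<union> B))\<^sup>*" if "q \<in> A \<union> B" for q
    using that assms unfolding edge_connected_def by blast
qed

lemma edge_connected_column:
  assumes "c \<le> d"
  shows "edge_connected ({x} \<times> {c..d})"
  using assms
proof (induction d rule: int_ge_induct)
  case base
  have "{x} \<times> {c..c} = {(x, c)}" by auto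
  then show ?case using edge_connected_singleton by metis
next
  case (step i)
  have "{x} \<times> {c..i + 1} = insert (x, i + 1) ({x} \<times> {c..i})" using step by auto
  then show ?case
    using edge_connected_insert[OF step.IH, of "(x, i)" "(x, i + 1)"] step by (simp add: edge_adjacent_def)
qed

lemma edge_connected_row:
  assumes "c \<le> d"
  shows "edge_connected ({c..d} \<times> {y})"
proof -
  have "{c..d} \<times> {y} = prod.swap ` ({y} \<times> {c..d})" by auto
  then show ?thesis
    using edge_connected_image[OF edge_connected_column[OF assms]] edge_adjacent_swap by metis
qed

lemma spans_cross:
  assumes "x \<in> {a..b}" "y \<in> {c..d}" "y' \<in> {c..d}"
  shows "spans (cross a b c d x y y') a b c d"
proof -
  \<comment> \<open>If an arm is empty, the extreme column is the full column itself, and its cell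
    at height \<open>c\<close> serves as witness.\<close>
  have "(a, if x = a then c else y) \<in> cross a b c d x y y'"
    "(b, if x = b then c else y') \<in> cross a b c d x y y'"
    "(x, c) \<in> cross a b c d x y y'" "(x, d) \<in> cross a b c d x y y'"
    using assms by (auto simp: mem_cross)
  then have "a \<in> fst ` cross a b c d x y y'" "b \<in> fst ` cross a b c d x y y'"
    "c \<in> snd ` cross a b c d x y y'" "d \<in> snd ` cross a b c d x y y'" by force+
  then show ?thesis unfolding spans_def using assms by (auto simp: cross_def)
qed

lemma edge_connected_cross:
  assumes "x \<in> {a..b}" "y \<in> {c..d}" "y' \<in> {c..d}"
  shows "edge_connected (cross a b c d x y y')"
proof -
  have "edge_connected ({x} \<times> {c..d} \<union> {a..x} \<times> {y} \<union> {x..b} \<times> {y'})"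
    using assms
    by (intro edge_connected_Un[of _ _ "(x, y')"] edge_connected_Un[of _ _ "(x, y)"]
        edge_connected_column edge_connected_row) auto
  moreover have "{x} \<times> {c..d} \<union> {a..x} \<times> {y} \<union> {x..b} \<times> {y'} = cross a b c d x y y'"
    using assms by (auto simp: cross_def)
  ultimately show ?thesis by simp
qed

text \<open>The homothety with centre \<open>(p, q)\<close> and ratio \<open>t\<close> maps the
  segment \<open>{x} \<times> {c..d}\<close> into \<open>C\<close>, onto a vertical segment of
  length \<open>t * (d - c)\<close>.\<close>

lemma triangle_slice:
  fixes C :: "(real \<times> real) set"
  assumes C: "convex C" "(p, q) \<in> C" "\<And>y. c \<le> y \<Longrightarrow> y \<le> d \<Longrightarrow> (x, y) \<in> C" and t: "0 \<le> t" "t \<le> 1"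
  shows "{(1 - t) * q + t * c..(1 - t) * q + t * d} \<subseteq> Pair ((1 - t) * p + t * x) -` C"
proof
  fix z assume z: "z \<in> {(1 - t) * q + t * c..(1 - t) * q + t * d}"
  show "z \<in> Pair ((1 - t) * p + t * x) -` C"
  proof (cases "t = 0")
    case True
    then show ?thesis using z C by auto
  next
    case False
    define y where "y = (z - (1 - t) * q) / t"
    have y: "c \<le> y" "y \<le> d" "t * y = z - (1 - t) * q"
      using z t False by (auto simp: y_def field_simps)
    have "(1 - t) *\<^sub>R (p, q) + t *\<^sub>R (x, y) \<in> C"
      using C y t by (intro convexD) auto
    then show ?thesis using y by simp
  qed
qed

text \<open>The hull contains the triangles over the full column with apexes at the ends of the
  arms. Their slices have length \<open>(d - c)\<close> times a tent, whatever the heights of the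
  apexes.\<close>

lemma corner_area_cross_ge:
  assumes "x \<in> {a..b}" "y \<in> {c..d}" "y' \<in> {c..d}"
  shows "of_int ((b - a) * (d - c)) / 2 \<le> corner_area (cross a b c d x y y')"
proof -
  let ?X = "cross a b c d x y y'"
  let ?C = "convex hull (corner ` ?X)"
  let ?t = "tent (of_int a) (of_int b) (of_int x)"
  have sp: "spans ?X a b c d" using assms by (rule spans_cross)
  have fin: "finite ?X" using sp by (simp add: spans_def)
  have C: "compact ?C" "convex ?C" using fin by (auto intro: compact_hull_corner)
  have ne: "?X \<noteq> {}" using assms by (auto simp: cross_def)
  have ab: "fst ` ?C \<subseteq> {of_int a..of_int b}"
  proof (rule order_trans[OF image_mono[OF hull_minimal[of _ "{of_int a..of_int b} \<times> UNIV"]]])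
    show "corner ` ?X \<subseteq> {of_int a..of_int b} \<times> UNIV"
      using sp by (auto simp: spans_def corner_def)
  qed (auto intro: convex_Times)
  have mem: "corner p \<in> ?C" if "p \<in> ?X" for p using that by (intro hull_inc) auto
  have col: "(of_int x, z) \<in> ?C" if "of_int c \<le> z" "z \<le> of_int d" for z :: real
  proof -
    have "corner (x, c) \<in> ?C" "corner (x, d) \<in> ?C" using assms by (auto intro!: mem simp: mem_cross simp del: corner_simps)
    then have "closed_segment (of_int x, of_int c) (of_int x, of_int d) \<subseteq> ?C"
      using C(2) by (simp add: closed_segment_subset)
    moreover have "(of_int x, z) \<in> closed_segment (of_int x, of_int c) (of_int x, of_int d)"
    proof -
      have "z \<in> closed_segment (of_int c) (of_int d)" using that by (auto simp: closed_segment_eq_real_ivl)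
      then obtain u where "0 \<le> u" "u \<le> 1" "z = (1 - u) * of_int c + u * of_int d"
        by (auto simp: closed_segment_def)
      then show ?thesis by (auto simp: closed_segment_def algebra_simps intro!: exI[of _ u])
    qed
    ultimately show ?thesis by blast
  qed
  have "of_int (d - c) * ?t \<xi> \<le> measure lborel (Pair \<xi> -` ?C)" if \<xi>: "\<xi> \<in> {of_int a..of_int b}" for \<xi>
  proof -
    have t: "0 \<le> ?t \<xi>" "?t \<xi> \<le> 1" using tent_bounds \<xi> by auto
    have "\<exists>p q. (p, q) \<in> ?C \<and> \<xi> = (1 - ?t \<xi>) * p + ?t \<xi> * of_int x"
    proof -
      consider "\<xi> < of_int x" | "\<xi> = of_int x" | "of_int x < \<xi>" by linarith
      then show ?thesis
      proof cases
        case 1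
        have "?t \<xi> * (of_int x - of_int a) = \<xi> - of_int a" using 1 \<xi> by (simp add: tent_def)
        then have "\<xi> = (1 - ?t \<xi>) * of_int a + ?t \<xi> * of_int x" by (simp add: algebra_simps)
        moreover have "(of_int a, of_int y) \<in> ?C" using mem[of "(a, y)"] 1 \<xi> by (simp add: mem_cross)
        ultimately show ?thesis by blast
      next
        case 2
        then show ?thesis using col[of "of_int c"] assms by (intro exI[of _ \<xi>] exI[of _ "of_int c"]) (simp add: tent_def)
      next
        case 3
        have "?t \<xi> * (of_int b - of_int x) = of_int b - \<xi>" using 3 \<xi> by (simp add: tent_def)
        then have "\<xi> = (1 - ?t \<xi>) * of_int b + ?t \<xi> * of_int x" by (simp add: algebra_simps)
        moreover have "(of_int b, of_int y') \<in> ?C" using mem[of "(b, y')"] 3 \<xi> by (simp add: mem_cross)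
        ultimately show ?thesis by blast
      qed
    qed
    then obtain p q where pq: "(p, q) \<in> ?C" "\<xi> = (1 - ?t \<xi>) * p + ?t \<xi> * of_int x" by blast
    have "{(1 - ?t \<xi>) * q + ?t \<xi> * of_int c..(1 - ?t \<xi>) * q + ?t \<xi> * of_int d} \<subseteq> Pair \<xi> -` ?C"
      using triangle_slice[OF C(2) pq(1) col t] pq(2) by simp
    from measure_slice_ge[OF C(1) this] show ?thesis by (simp add: algebra_simps)
  qed
  note le = this
  have "((\<lambda>\<xi>. of_int (d - c) * ?t \<xi>) has_integral of_int (d - c) * ((of_int b - of_int a) / 2)) {of_int a..of_int b}"
    using assms by (intro has_integral_mult_right tent_has_integral) auto
  from has_integral_le[OF this slice_has_integral[OF C(1) ab] le]
  show ?thesis by (simp add: corner_area_def algebra_simps)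
qed

lemma extremal_cross:
  assumes "x \<in> {a..b}" "y \<in> {c..d}" "y' \<in> {c..d}"
  shows "extremal (cross a b c d x y y')" "card (cross a b c d x y y') = nat (b - a + d - c + 1)"
proof -
  let ?X = "cross a b c d x y y'"
  have sp: "spans ?X a b c d" using assms by (rule spans_cross)
  note dims = spans_dims[OF sp]
  have fin: "finite ?X" using sp by (simp add: spans_def)
  have ne: "?X \<noteq> {}" using assms by (auto simp: cross_def)
  have conn: "edge_connected ?X" using assms by (rule edge_connected_cross)
  \<comment> \<open>The union bound gives one inequality for the number of cells,
    \<open>card_ge\<close> the other.\<close>
  have "card ?X \<le> card ({x} \<times> {c..d}) + card ({a..<x} \<times> {y}) + card ({x<..b} \<times> {y'})"
    unfolding cross_def by (meson add_mono card_Un_le le_trans order_refl)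
  then have "card ?X \<le> nat (d - c + 1) + nat (x - a) + nat (b - x)"
    by (simp add: card_cartesian_product)
  then have "int (card ?X) \<le> int (nat (d - c + 1) + nat (x - a) + nat (b - x))"
    by (simp only: of_nat_le_iff)
  also have "\<dots> = width ?X + height ?X + 1" using assms dims by auto
  finally have "int (card ?X) \<le> width ?X + height ?X + 1" .
  then have card: "int (card ?X) = width ?X + height ?X + 1" using card_ge[OF fin ne conn] by linarith
  then show "card ?X = nat (b - a + d - c + 1)" using dims by simp
  show "extremal ?X"
    using corner_area_le[OF fin ne conn card] corner_area_cross_ge[OF assms] fin ne conn card dims
    by (simp add: extremal_def)
qed

section \<open>The maximum of the hull area\<close>

lemma floor_mult_ceil_max:
  fixes h v m :: nat
  assumes "h + v = m"
  shows "h * v \<le> (m div 2) * ((m + 1) div 2)"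
    "h * v = (m div 2) * ((m + 1) div 2) \<Longrightarrow> (h = m div 2 \<and> v = (m + 1) div 2) \<or> (h = (m + 1) div 2 \<and> v = m div 2)"
proof -
  define k l where "k = m div 2" and "l = (m + 1) div 2"
  have kl: "k + l = m" "l = k \<or> l = k + 1" unfolding k_def l_def by presburger+
  \<comment> \<open>Since \<open>k\<close> and \<open>l\<close> are equal or consecutive, no integer
    lies strictly between them: the right side is nonnegative and vanishes only for
    \<open>h = k\<close> or \<open>h = l\<close>.\<close>
  have id: "int k * int l - int h * int v = (int h - int k) * (int h - int l)"
  proof -
    have v: "int v = int k + int l - int h" using kl assms by linarith
    show ?thesis unfolding v by (simp add: algebra_simps)
  qed
  have nn: "0 \<le> (int h - int k) * (int h - int l)"
    using kl(2) by (cases "h \<le> k") (auto intro: mult_nonpos_nonpos)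
  have "int (h * v) \<le> int (k * l)" using id nn by simp
  then show "h * v \<le> (m div 2) * ((m + 1) div 2)" unfolding k_def l_def by (simp only: of_nat_le_iff)
  show "(h = m div 2 \<and> v = (m + 1) div 2) \<or> (h = (m + 1) div 2 \<and> v = m div 2)"
    if "h * v = (m div 2) * ((m + 1) div 2)"
  proof -
    have "int k * int l - int h * int v = 0"
      using that unfolding k_def[symmetric] l_def[symmetric] by (metis diff_self of_nat_mult)
    then have "h = k \<or> h = l" using id by simp
    then show ?thesis unfolding k_def[symmetric] l_def[symmetric] using kl assms by auto
  qed
qed

lemma hull_area_le:
  assumes "P \<in> polyominoes n" "1 \<le> n"
  shows "hull_area P \<le> real n + 1 / 2 * real ((n - 1) div 2) * real (n div 2)"
    and "hull_area P = real n + 1 / 2 * real ((n - 1) div 2) * real (n div 2) \<Longrightarrow>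
      extremal P \<and> ((width P = int ((n - 1) div 2) \<and> height P = int (n div 2)) \<or>
        (width P = int (n div 2) \<and> height P = int ((n - 1) div 2)))"
proof -
  have P: "finite P" "P \<noteq> {}" "edge_connected P" and n: "card P = n" using assms by (auto simp: polyominoes_def)
  obtain h v where hv: "h + v + 1 = card P" "width P \<le> int h" "height P \<le> int v" "corner_area P \<le> real (h * v) / 2"
    using corner_area_bound[OF P] .
  have hv': "h + v = n - 1" and n1: "n - 1 + 1 = n" using hv n assms by auto
  have area: "hull_area P = corner_area P + of_int (width P) + of_int (height P) + 1"
    using hull_area_eq P by blast
  note mx = floor_mult_ceil_max[OF hv', unfolded n1]
  have "real (h * v) \<le> real ((n - 1) div 2 * (n div 2))" using mx(1) of_nat_le_iff by blast
  then have hv2: "real (h * v) / 2 \<le> 1 / 2 * real ((n - 1) div 2) * real (n div 2)" by simp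
  have w: "of_int (width P) \<le> real h" "of_int (height P) \<le> real v" using hv by linarith+
  have rn: "real n = real h + real v + 1" using hv n by linarith
  show "hull_area P \<le> real n + 1 / 2 * real ((n - 1) div 2) * real (n div 2)"
    using area hv(4) hv2 w rn by linarith
  assume "hull_area P = real n + 1 / 2 * real ((n - 1) div 2) * real (n div 2)"
  \<comment> \<open>The total is an equality, so each of the separate upper bounds added up in it is
    attained.\<close>
  then have eq: "corner_area P = real (h * v) / 2" "real (h * v) / 2 = 1 / 2 * real ((n - 1) div 2) * real (n div 2)"
    "of_int (width P) = real h" "of_int (height P) = real v"
    using area hv(4) hv2 w rn by linarith+
  have "real (h * v) = real ((n - 1) div 2 * (n div 2))" using eq(2) by simp
  then have "h * v = (n - 1) div 2 * (n div 2)" by (simp only: of_nat_eq_iff)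
  from mx(2)[OF this] have or: "h = (n - 1) div 2 \<and> v = n div 2 \<or> h = n div 2 \<and> v = (n - 1) div 2" .
  have wh: "width P = int h" "height P = int v" using eq by linarith+
  then have "extremal P" using P hv(1) eq(1) by (simp add: extremal_def)
  then show "extremal P \<and> ((width P = int ((n - 1) div 2) \<and> height P = int (n div 2)) \<or>
        (width P = int (n div 2) \<and> height P = int ((n - 1) div 2)))"
    using or wh by auto
qed

lemma max_hull_iff:
  assumes "1 \<le> n"
  shows "P \<in> max_hull_polyominoes n \<longleftrightarrow>
      extremal P \<and> ((width P = int ((n - 1) div 2) \<and> height P = int (n div 2)) \<or>
        (width P = int (n div 2) \<and> height P = int ((n - 1) div 2)))" (is "_ \<longleftrightarrow> ?E P")
    and "P \<in> max_hull_polyominoes n \<Longrightarrow> hull_area P = real n + 1 / 2 * real ((n - 1) div 2) * real (n div 2)"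
proof -
  let ?f = "real n + 1 / 2 * real ((n - 1) div 2) * real (n div 2)"
  have sum: "int ((n - 1) div 2) + int (n div 2) + 1 = int n" using assms by presburger
  have E: "P \<in> polyominoes n \<and> hull_area P = ?f" if "?E P" for P
  proof -
    have P: "finite P" "P \<noteq> {}" "edge_connected P" "int (card P) = width P + height P + 1"
      "corner_area P = of_int (width P * height P) / 2" using that by (auto simp: extremal_def)
    have "card P = n" using that sum P(4) by linarith
    moreover have "of_int (width P) + of_int (height P) + 1 = real n"
      using that sum by linarith
    moreover have "corner_area P = 1 / 2 * real ((n - 1) div 2) * real (n div 2)"
      using that P(5) by auto
    ultimately show ?thesis using hull_area_eq[OF P(1,2)] P by (simp add: polyominoes_def)
  qed
  \<comment> \<open>An L-shaped cross attains the bound, so the maximum equals it.\<close>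
  let ?X = "cross 0 (int (n div 2)) 0 (int ((n - 1) div 2)) 0 0 0"
  have "extremal ?X" "spans ?X 0 (int (n div 2)) 0 (int ((n - 1) div 2))"
    by (intro extremal_cross spans_cross; simp)+
  then have X: "?E ?X" using spans_dims[of ?X 0 "int (n div 2)" 0 "int ((n - 1) div 2)"] by simp
  have area: "hull_area P = ?f" if "P \<in> max_hull_polyominoes n" for P
    using that E[OF X] hull_area_le(1)[OF _ assms, of P] by (force simp: max_hull_polyominoes_def)
  show "P \<in> max_hull_polyominoes n \<Longrightarrow> hull_area P = ?f" by (rule area)
  show "P \<in> max_hull_polyominoes n \<longleftrightarrow> ?E P"
  proof
    assume P: "P \<in> max_hull_polyominoes n"
    then show "?E P" using hull_area_le(2)[OF _ assms area[OF P]] by (simp add: max_hull_polyominoes_def)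
  next
    assume "?E P"
    then show "P \<in> max_hull_polyominoes n"
      using E[of P] hull_area_le(1)[OF _ assms] by (simp add: max_hull_polyominoes_def)
  qed
qed

section \<open>Counting orbits of extremal shapes\<close>

text \<open>Two labellings with the same kernel have equally many values; this later identifies the
  number of congruence classes with the number of orbits.\<close>

lemma card_image_eq_card_image:
  assumes "\<And>x y. x \<in> X \<Longrightarrow> y \<in> X \<Longrightarrow> f x = f y \<longleftrightarrow> g x = g y"
  shows "card (f ` X) = card (g ` X)"
proof (rule bij_betw_same_card)
  let ?h = "\<lambda>z. g (inv_into X f z)"
  have h: "?h (f x) = g x" if "x \<in> X" for x
    using assms[OF inv_into_into[of "f x" f X] that] f_inv_into_f[of "f x" f X] that by auto
  show "bij_betw ?h (f ` X) (g ` X)"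
    unfolding bij_betw_def inj_on_def using h assms by (auto simp: image_image)
qed

text \<open>Phrased for an indexed family of maps: \<open>comp\<close> says that right
  multiplication by \<open>j\<close> permutes the indices. Over one orbit, the indices fixing a
  point are as many as those carrying \<open>x\<close> to it, so the stabilizer counts add up to
  \<open>card I\<close>.\<close>

lemma burnside_orbit_count:
  fixes act :: "'i \<Rightarrow> 'a \<Rightarrow> 'a"
  assumes fin: "finite I" "finite X"
    and closed: "\<And>i x. i \<in> I \<Longrightarrow> x \<in> X \<Longrightarrow> act i x \<in> X"
    and unit: "e \<in> I" "\<And>x. x \<in> X \<Longrightarrow> act e x = x"
    and comp: "\<And>j. j \<in> I \<Longrightarrow> \<exists>\<pi>. bij_betw \<pi> I I \<and> (\<forall>i\<in>I. \<forall>x\<in>X. act (\<pi> i) x = act i (act j x))"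
  defines "orb \<equiv> \<lambda>x. (\<lambda>i. act i x) ` I"
  shows "card I * card (orb ` X) = (\<Sum>i\<in>I. card {x \<in> X. act i x = x})"
    and "\<And>x y. x \<in> X \<Longrightarrow> y \<in> X \<Longrightarrow> orb x = orb y \<longleftrightarrow> y \<in> orb x"
proof -
  have self: "x \<in> orb x" if "x \<in> X" for x
    using unit that unfolding orb_def by force
  have orb_act: "orb (act j x) = orb x" if j: "j \<in> I" and x: "x \<in> X" for j x
  proof -
    obtain \<pi> where \<pi>: "bij_betw \<pi> I I" "\<forall>i\<in>I. \<forall>x\<in>X. act (\<pi> i) x = act i (act j x)" using comp[OF j] by blast
    have "orb (act j x) = (\<lambda>i. act (\<pi> i) x) ` I" using \<pi> x by (auto simp: orb_def)
    also have "\<dots> = (\<lambda>i. act i x) ` \<pi> ` I" by (simp add: image_image)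
    finally show ?thesis using \<pi> by (simp add: orb_def bij_betw_def)
  qed
  show orb_iff: "orb x = orb y \<longleftrightarrow> y \<in> orb x" if "x \<in> X" "y \<in> X" for x y
    using self[OF that(2)] orb_act that(1) unfolding orb_def by blast
  have stab: "card {i \<in> I. act i y = y} = card {i \<in> I. act i x = y}" if x: "x \<in> X" and y: "y \<in> orb x" for x y
  proof -
    obtain j where j: "j \<in> I" "y = act j x" using y by (auto simp: orb_def)
    obtain \<pi> where \<pi>: "bij_betw \<pi> I I" "\<forall>i\<in>I. \<forall>x\<in>X. act (\<pi> i) x = act i (act j x)" using comp[OF j(1)] by blast
    \<comment> \<open>Right translation by \<open>j\<close> carries the stabilizer of
      \<open>y\<close> onto the set of indices that move \<open>x\<close> to
      \<open>y\<close>.\<close>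
    have "bij_betw \<pi> {i \<in> I. act i y = y} {i \<in> I. act i x = y}"
    proof (rule bij_betw_subset[OF \<pi>(1)])
      show "\<pi> ` {i \<in> I. act i y = y} = {i \<in> I. act i x = y}"
      proof (intro equalityI subsetI)
        fix k assume k: "k \<in> {i \<in> I. act i x = y}"
        then obtain i where "i \<in> I" "k = \<pi> i" using \<pi>(1) by (auto simp: bij_betw_def)
        then show "k \<in> \<pi> ` {i \<in> I. act i y = y}" using k \<pi>(2) x j by auto
      next
        fix k assume "k \<in> \<pi> ` {i \<in> I. act i y = y}"
        then show "k \<in> {i \<in> I. act i x = y}" using \<pi> x j by (auto simp: bij_betw_def)
      qed
    qed auto
    then show ?thesis by (rule bij_betw_same_card)
  qed
  have orbsum: "(\<Sum>y\<in>{y \<in> X. orb y = orb x}. card {i \<in> I. act i y = y}) = card I" if x: "x \<in> X" for x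
  proof -
    have "orb x \<subseteq> X" using closed x by (auto simp: orb_def)
    then have eq: "{y \<in> X. orb y = orb x} = orb x" using orb_iff x by blast
    have "(\<Sum>y\<in>orb x. card {i \<in> I. act i y = y}) = (\<Sum>y\<in>orb x. card {i \<in> I. act i x = y})"
      using stab x by (intro sum.cong) auto
    also have "\<dots> = (\<Sum>y\<in>(\<lambda>i. act i x) ` I. \<Sum>i\<in>{i \<in> I. act i x = y}. 1)"
      by (simp add: orb_def)
    also have "\<dots> = (\<Sum>i\<in>I. 1)"
      by (rule sum.image_gen[symmetric, OF fin(1)])
    finally show ?thesis by (simp add: eq)
  qed
  have card_filter: "card {x \<in> Y. Q x} = (\<Sum>x\<in>Y. if Q x then 1 else 0)" if "finite Y"
    for Q and Y :: "'b set"
    using that by (simp add: sum.If_cases Int_def)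
  have "(\<Sum>i\<in>I. card {x \<in> X. act i x = x}) = (\<Sum>x\<in>X. card {i \<in> I. act i x = x})"
    by (simp add: card_filter fin sum.swap[of _ X I])
  also have "\<dots> = (\<Sum>Z\<in>orb ` X. \<Sum>x\<in>{x \<in> X. orb x = Z}. card {i \<in> I. act i x = x})"
    by (rule sum.image_gen[OF fin(2)])
  also have "\<dots> = (\<Sum>Z\<in>orb ` X. card I)"
    using orbsum by (intro sum.cong) auto
  finally show "card I * card (orb ` X) = (\<Sum>i\<in>I. card {x \<in> X. act i x = x})" by simp
qed

text \<open>If \<open>f\<close> acts on the parameters as \<open>\<phi>\<close>, injectivity of
  \<open>p\<close> makes fixed shapes the same as fixed parameters.\<close>

lemma card_fixed_image:
  assumes "inj_on p D" "\<And>d. d \<in> D \<Longrightarrow> f (p d) = p (\<phi> d) \<and> \<phi> d \<in> D"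
  shows "card {S \<in> p ` D. f S = S} = card {d \<in> D. \<phi> d = d}"
proof -
  have "{S \<in> p ` D. f S = S} = p ` {d \<in> D. \<phi> d = d}"
    using assms by (auto simp: inj_on_def)
  moreover have "inj_on p {d \<in> D. \<phi> d = d}" using assms(1) by (rule inj_on_subset) auto
  ultimately show ?thesis by (simp add: card_image)
qed

text \<open>The symmetries of the box \<open>{0..A} \<times> {0..B}\<close>; the ones with \<open>s\<close> are only used when \<open>A = B\<close>.\<close>

fun box_sym :: "int \<Rightarrow> int \<Rightarrow> bool \<times> bool \<times> bool \<Rightarrow> cell \<Rightarrow> cell" where
  "box_sym A B (s, u, v) (x, y) =
     (if u then A - (if s then y else x) else (if s then y else x),
      if v then B - (if s then x else y) else (if s then x else y))"

definition box_syms :: "int \<Rightarrow> int \<Rightarrow> (bool \<times> bool \<times> bool) set" where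
  "box_syms A B = (if A = B then UNIV else {False}) \<times> UNIV"

lemma box_sym_comp:
  assumes "j \<in> box_syms A B"
  shows "\<exists>\<pi>. bij_betw \<pi> (box_syms A B) (box_syms A B) \<and>
    (\<forall>i\<in>box_syms A B. \<forall>c. box_sym A B (\<pi> i) c = box_sym A B i (box_sym A B j c))"
proof -
  obtain s' u' v' where j: "j = (s', u', v')" by (cases j)
  \<comment> \<open>The multiplication table: a symmetry transposes first and flips afterwards, so a
    transposition in \<open>i\<close> exchanges the flips coming from \<open>j\<close>.\<close>
  define \<pi> where "\<pi> = (\<lambda>(s, u, v). (s \<noteq> s', if s then u \<noteq> v' else u \<noteq> u', if s then v \<noteq> u' else v \<noteq> v'))"
  have fin: "finite (box_syms A B)" by (simp add: box_syms_def)
  have inj: "inj_on \<pi> (box_syms A B)" by (auto simp: inj_on_def \<pi>_def split: if_splits)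
  have sub: "\<pi> ` box_syms A B \<subseteq> box_syms A B"
    using assms by (auto simp: box_syms_def \<pi>_def j)
  have "bij_betw \<pi> (box_syms A B) (box_syms A B)"
    unfolding bij_betw_def using inj endo_inj_surj[OF fin sub inj] by (rule conjI)
  moreover have "box_sym A B (\<pi> i) c = box_sym A B i (box_sym A B j c)" if "i \<in> box_syms A B" for i c
  proof -
    obtain s u v where i: "i = (s, u, v)" by (cases i)
    obtain x y where c: "c = (x, y)" by fastforce
    show ?thesis
    proof (cases "A = B")
      case True
      then show ?thesis by (simp add: i j c \<pi>_def)
    next
      case False
      then have "\<not> s" "\<not> s'" using that assms by (auto simp: box_syms_def i j)
      then show ?thesis by (simp add: i j c \<pi>_def)
    qed
  qed
  ultimately show ?thesis by blast
qed

section \<open>Normal forms of the extremal shapes\<close>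

definition shapes :: "int \<Rightarrow> int \<Rightarrow> cell set set" where
  "shapes A B = {S. extremal S \<and> spans S 0 A 0 B}"

definition box_cross :: "int \<Rightarrow> int \<Rightarrow> int \<times> int \<times> int \<Rightarrow> cell set" where
  "box_cross A B = (\<lambda>(x, y, y'). cross 0 A 0 B x y y')"

definition plus_params :: "int \<Rightarrow> int \<Rightarrow> (int \<times> int) set" where
  "plus_params A B = {0..A} \<times> {0..B}"

text \<open>An end column or equal arm heights would give a plus shape; excluding them keeps the
  families disjoint and the parameters unique.\<close>

definition bent_params :: "int \<Rightarrow> int \<Rightarrow> (int \<times> int \<times> int) set" where
  "bent_params A B = {(x, y, y'). 0 < x \<and> x < A \<and> y \<in> {0..B} \<and> y' \<in> {0..B} \<and> y \<noteq> y'}"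

definition plus_shape :: "int \<Rightarrow> int \<Rightarrow> int \<times> int \<Rightarrow> cell set" where
  "plus_shape A B = (\<lambda>(x, y). cross 0 A 0 B x y y)"

lemma mem_plus: "(x, y) \<in> plus_params A B \<Longrightarrow>
    (i, j) \<in> plus_shape A B (x, y) \<longleftrightarrow> i = x \<and> j \<in> {0..B} \<or> j = y \<and> i \<noteq> x \<and> i \<in> {0..A}"
  by (auto simp: plus_shape_def mem_cross plus_params_def)

lemma swap_swap_image: "prod.swap ` prod.swap ` S = S"
  by (simp add: image_image)

lemma swap_plus: "(x, y) \<in> plus_params A B \<Longrightarrow> prod.swap ` plus_shape A B (x, y) = plus_shape B A (y, x)"
proof (rule set_eqI)
  fix c :: cell assume "(x, y) \<in> plus_params A B"
  then show "c \<in> prod.swap ` plus_shape A B (x, y) \<longleftrightarrow> c \<in> plus_shape B A (y, x)"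
    by (cases c) (auto simp: plus_shape_def mem_cross plus_params_def)
qed

lemma shapes_swap: "prod.swap ` S \<in> shapes B A \<longleftrightarrow> S \<in> shapes A B"
proof -
  have "prod.swap ` S \<in> shapes B A" if "S \<in> shapes A B" for S A B
    using that extremal_swap spans_swap by (auto simp: shapes_def)
  from this[of S A B] this[of "prod.swap ` S" B A] show ?thesis by (auto simp: image_image)
qed

text \<open>A full line makes the shape a cross, up to transposition; crosses that also contain a
  full line in the other direction go to the plus family.\<close>

lemma shapes_eq:
  assumes "0 \<le> A" "0 \<le> B"
  shows "shapes A B = plus_shape A B ` plus_params A B \<union> box_cross A B ` bent_params A B
    \<union> (\<lambda>d. prod.swap ` box_cross B A d) ` bent_params B A"
proof -
  have cross_shape: "cross 0 A 0 B x y y' \<in> shapes A B"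
    if "x \<in> {0..A}" "y \<in> {0..B}" "y' \<in> {0..B}" for x y y' A B
    using extremal_cross[OF that] spans_cross[OF that] by (simp add: shapes_def)
  have col: "S \<in> plus_shape A B ` plus_params A B \<union> box_cross A B ` bent_params A B"
    if S: "S \<in> shapes A B" and x: "\<forall>y\<in>snd ` S. (x, y) \<in> S" for S x A B
  proof -
    have ext: "extremal S" and sp: "spans S 0 A 0 B" using S by (auto simp: shapes_def)
    have conn: "edge_connected S" using ext by (simp add: extremal_def)
    have full: "(x, j) \<in> S" if "0 \<le> j" "j \<le> B" for j using x spans_snd[OF conn sp] that by auto
    obtain y y' where y: "y \<in> {0..B}" "y' \<in> {0..B}" "S = cross 0 A 0 B x y y'"
      using cross_of_full_col[OF conn sp _ full] ext spans_dims[OF sp] by (auto simp: extremal_def)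
    have "(x, 0) \<in> S" using full spans_dims[OF sp] by auto
    then have xA: "x \<in> {0..A}" using sp by (auto simp: spans_def)
    consider "x = 0" | "x = A" | "y = y'" | "0 < x" "x < A" "y \<noteq> y'" using xA by force
    then show ?thesis
    proof cases
      case 1
      \<comment> \<open>In the first column the left arm is empty, so its height may be taken equal
        to that of the right arm.\<close>
      then have "S = plus_shape A B (x, y')" using y by (auto simp: plus_shape_def cross_def)
      then show ?thesis using xA y by (auto simp: plus_params_def)
    next
      case 2
      then have "S = plus_shape A B (x, y)" using y by (auto simp: plus_shape_def cross_def)
      then show ?thesis using xA y by (auto simp: plus_params_def)
    next
      case 3
      then have "S = plus_shape A B (x, y)" using y by (auto simp: plus_shape_def)
      then show ?thesis using xA y by (auto simp: plus_params_def)
    next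
      case 4
      then have "S = box_cross A B (x, y, y')" "(x, y, y') \<in> bent_params A B" using y by (auto simp: box_cross_def bent_params_def)
      then show ?thesis by blast
    qed
  qed
  show ?thesis
  proof (intro equalityI subsetI)
    fix S assume S: "S \<in> shapes A B"
    then have "full_line S" using extremal_full_line by (auto simp: shapes_def)
    then consider x where "\<forall>y\<in>snd ` S. (x, y) \<in> S" | y where "\<forall>x\<in>fst ` S. (x, y) \<in> S"
      by (auto simp: full_line_def)
    then show "S \<in> plus_shape A B ` plus_params A B \<union> box_cross A B ` bent_params A B
        \<union> (\<lambda>d. prod.swap ` box_cross B A d) ` bent_params B A"
    proof cases
      case 1
      then show ?thesis using col[OF S] by blast
    next
      case 2
      have S': "prod.swap ` S \<in> shapes B A" using S shapes_swap by blast
      have "\<forall>x\<in>snd ` prod.swap ` S. (y, x) \<in> prod.swap ` S"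
        using 2 by (simp add: image_image)
      from col[OF S' this] consider p q where "(p, q) \<in> plus_params B A" "prod.swap ` S = plus_shape B A (p, q)"
        | d where "d \<in> bent_params B A" "prod.swap ` S = box_cross B A d" by auto
      then show ?thesis
      proof cases
        case 1
        then have "S = prod.swap ` plus_shape B A (p, q)" using swap_swap_image[of S] by simp
        then have "S = plus_shape A B (q, p)" using swap_plus[OF 1(1)] by simp
        then show ?thesis using 1(1) by (auto simp: plus_params_def)
      next
        case 2
        then have "S = prod.swap ` box_cross B A d" using swap_swap_image[of S] by simp
        then show ?thesis using 2(1) by blast
      qed
    qed
  next
    fix S assume "S \<in> plus_shape A B ` plus_params A B \<union> box_cross A B ` bent_params A B
        \<union> (\<lambda>d. prod.swap ` box_cross B A d) ` bent_params B A"
    then show "S \<in> shapes A B"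
      using cross_shape[of _ A _ B] cross_shape[of _ B _ A]
      by (auto simp: plus_shape_def box_cross_def plus_params_def bent_params_def shapes_swap simp del: image_iff)
  qed
qed

definition flip :: "bool \<Rightarrow> int \<Rightarrow> int \<Rightarrow> int" where
  "flip u A x = (if u then A - x else x)"

text \<open>Reversing the horizontal direction exchanges the two arms, hence the exchange of
  \<open>y\<close> and \<open>y'\<close> under \<open>u\<close>.\<close>

definition flip_params :: "int \<Rightarrow> int \<Rightarrow> bool \<Rightarrow> bool \<Rightarrow> int \<times> int \<times> int \<Rightarrow> int \<times> int \<times> int" where
  "flip_params A B u v = (\<lambda>(x, y, y').
     (flip u A x, flip v B (if u then y' else y), flip v B (if u then y else y')))"

text \<open>Flips are involutions, so the image is the preimage under the same flips.\<close>

lemma mem_box_sym_image: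
  "(i, j) \<in> box_sym A B (False, u, v) ` S \<longleftrightarrow> (flip u A i, flip v B j) \<in> S"
proof
  assume "(flip u A i, flip v B j) \<in> S"
  then have "box_sym A B (False, u, v) (flip u A i, flip v B j) \<in> box_sym A B (False, u, v) ` S" by blast
  moreover have "box_sym A B (False, u, v) (flip u A i, flip v B j) = (i, j)" by (cases u; cases v) (simp_all add: flip_def)
  ultimately show "(i, j) \<in> box_sym A B (False, u, v) ` S" by simp
qed (auto simp: flip_def)

lemma box_sym_True: "box_sym A B (True, u, v) ` S = box_sym A B (False, u, v) ` prod.swap ` S"
  unfolding image_image by (intro image_cong) auto

text \<open>Pulling the transposition out exchanges the roles of the two flips, and with it the
  order of \<open>u\<close> and \<open>v\<close> in the counts for shapes with a full row
  only.\<close>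

lemma box_sym_swap: "box_sym A B (False, u, v) ` prod.swap ` S = prod.swap ` box_sym B A (False, v, u) ` S"
  unfolding image_image by (intro image_cong) auto

lemma box_sym_cross: "box_sym A B (False, u, v) ` box_cross A B d = box_cross A B (flip_params A B u v d)"
proof (rule set_eqI)
  fix c :: cell
  obtain i j where c: "c = (i, j)" by fastforce
  obtain x y y' where d: "d = (x, y, y')" by (cases d)
  show "c \<in> box_sym A B (False, u, v) ` box_cross A B d \<longleftrightarrow> c \<in> box_cross A B (flip_params A B u v d)"
    unfolding c d mem_box_sym_image box_cross_def flip_params_def prod.case mem_cross
    by (cases u; cases v) (auto simp: flip_def)
qed

lemma plus_shape_eq: "plus_shape A B (x, y) = box_cross A B (x, y, y)"
  by (simp add: plus_shape_def box_cross_def)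

lemma box_sym_plus: "box_sym A B (False, u, v) ` plus_shape A B (x, y) = plus_shape A B (flip u A x, flip v B y)"
  by (simp only: plus_shape_eq box_sym_cross flip_params_def prod.case if_cancel)

lemma flip_params_bent: "d \<in> bent_params A B \<Longrightarrow> flip_params A B u v d \<in> bent_params A B"
  by (cases u; cases v) (auto simp: bent_params_def flip_params_def flip_def)

text \<open>Distinguishes the three families: plus shapes have a full row and a full column, bent
  crosses no full row, transposed bent crosses no full column.\<close>

definition has_row :: "int \<Rightarrow> cell set \<Rightarrow> bool" where
  "has_row A S \<longleftrightarrow> (\<exists>r. \<forall>i\<in>{0..A}. (i, r) \<in> S)"

lemma has_row_plus: "(x, y) \<in> plus_params A B \<Longrightarrow> has_row A (plus_shape A B (x, y))"
  unfolding has_row_def by (rule exI[of _ y]) (auto simp: mem_plus plus_params_def)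

lemma has_row_box_cross: "d \<in> bent_params A B \<Longrightarrow> \<not> has_row A (box_cross A B d)"
proof
  assume d: "d \<in> bent_params A B" "has_row A (box_cross A B d)"
  obtain x y y' where xyz: "d = (x, y, y')" by (cases d)
  obtain r where "\<forall>i\<in>{0..A}. (i, r) \<in> box_cross A B d" using d(2) by (auto simp: has_row_def)
  then have "(0, r) \<in> box_cross A B d" "(A, r) \<in> box_cross A B d" using d(1) by (auto simp: bent_params_def xyz)
  then show False using d(1) by (auto simp: bent_params_def xyz box_cross_def mem_cross)
qed

lemma has_row_swap_box_cross:
  assumes "d \<in> bent_params B A"
  shows "has_row A (prod.swap ` box_cross B A d)"
proof -
  obtain x y y' where xyz: "d = (x, y, y')" by (cases d)
  show ?thesis unfolding has_row_def
    by (rule exI[of _ x]) (simp add: xyz box_cross_def mem_cross)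
qed

text \<open>The ends of the full column and of the full row determine both parameters once the box
  is nondegenerate.\<close>

lemma inj_plus:
  assumes "1 \<le> A" "1 \<le> B"
  shows "inj_on (plus_shape A B) (plus_params A B)"
proof (rule inj_onI)
  fix d e assume d: "d \<in> plus_params A B" and e: "e \<in> plus_params A B" and eq: "plus_shape A B d = plus_shape A B e"
  obtain x y p q where xy: "d = (x, y)" "e = (p, q)" by fastforce
  have "(p, 0) \<in> plus_shape A B e" "(p, B) \<in> plus_shape A B e" "(0, q) \<in> plus_shape A B e" "(A, q) \<in> plus_shape A B e"
    using e assms by (auto simp: xy plus_shape_def mem_cross plus_params_def)
  then have "(p, 0) \<in> plus_shape A B d" "(p, B) \<in> plus_shape A B d" "(0, q) \<in> plus_shape A B d" "(A, q) \<in> plus_shape A B d"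
    using eq by simp_all
  then show "d = e" using assms d by (auto simp: xy mem_plus)
qed

lemma inj_box_cross: "inj_on (box_cross A B) (bent_params A B)"
proof (rule inj_onI)
  fix d e assume d: "d \<in> bent_params A B" and e: "e \<in> bent_params A B" and eq: "box_cross A B d = box_cross A B e"
  obtain x y y' p q q' where xy: "d = (x, y, y')" "e = (p, q, q')" by (cases d, cases e)
  have "(p, 0) \<in> box_cross A B e" "(p, B) \<in> box_cross A B e" "(0, q) \<in> box_cross A B e" "(A, q') \<in> box_cross A B e"
    using e by (auto simp: xy box_cross_def mem_cross bent_params_def)
  then have "(p, 0) \<in> box_cross A B d" "(p, B) \<in> box_cross A B d" "(0, q) \<in> box_cross A B d" "(A, q') \<in> box_cross A B d"
    using eq by simp_all
  then show "d = e" using d e by (auto simp: xy box_cross_def mem_cross bent_params_def)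
qed

section \<open>Shapes fixed by each box symmetry\<close>

lemma finite_params: "finite (plus_params A B)" "finite (bent_params A B)"
proof -
  have "bent_params A B \<subseteq> {0..A} \<times> {0..B} \<times> {0..B}" by (auto simp: bent_params_def)
  then show "finite (bent_params A B)" by (rule finite_subset) simp
qed (simp add: plus_params_def)

lemma finite_shapes: "0 \<le> A \<Longrightarrow> 0 \<le> B \<Longrightarrow> finite (shapes A B)"
  by (simp add: shapes_eq finite_params)

lemma card_fixed_shapes:
  assumes "1 \<le> A" "1 \<le> B"
  shows "card {S \<in> shapes A B. F S} = card {S \<in> plus_shape A B ` plus_params A B. F S}
    + card {S \<in> box_cross A B ` bent_params A B. F S} + card {S \<in> (\<lambda>d. prod.swap ` box_cross B A d) ` bent_params B A. F S}"
proof -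
  let ?P = "{S \<in> plus_shape A B ` plus_params A B. F S}"
  let ?V = "{S \<in> box_cross A B ` bent_params A B. F S}"
  let ?H = "{S \<in> (\<lambda>d. prod.swap ` box_cross B A d) ` bent_params B A. F S}"
  have fin: "finite ?P" "finite ?V" "finite ?H" by (simp_all add: finite_params)
  have P: "has_row A S \<and> has_row B (prod.swap ` S)" if S: "S \<in> ?P" for S
  proof -
    obtain d where "S = plus_shape A B d" "d \<in> plus_params A B" using S by blast
    then obtain x y where xy: "S = plus_shape A B (x, y)" "(x, y) \<in> plus_params A B" by (cases d) blast
    then have "prod.swap ` S = plus_shape B A (y, x)" "(y, x) \<in> plus_params B A"
      using swap_plus by (auto simp: plus_params_def)
    then show ?thesis using xy has_row_plus by metis
  qed
  have V: "\<not> has_row A S" if "S \<in> ?V" for S using that has_row_box_cross by auto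
  have H: "has_row A S \<and> \<not> has_row B (prod.swap ` S)" if S: "S \<in> ?H" for S
  proof -
    obtain d where d: "S = prod.swap ` box_cross B A d" "d \<in> bent_params B A" using S by blast
    then have "prod.swap ` S = box_cross B A d" by (simp add: swap_swap_image)
    then show ?thesis using d has_row_box_cross has_row_swap_box_cross by metis
  qed
  have disj: "?P \<inter> ?V = {}" "(?P \<union> ?V) \<inter> ?H = {}" using P V H by blast+
  have "{S \<in> shapes A B. F S} = ?P \<union> ?V \<union> ?H"
    using assms by (auto simp: shapes_eq)
  then show ?thesis using disj fin by (simp add: card_Un_disjoint)
qed

lemma card_fixed_no_swap:
  assumes "1 \<le> A" "1 \<le> B"
  shows "card {S \<in> shapes A B. box_sym A B (False, u, v) ` S = S} =
    card {(x, y) \<in> plus_params A B. flip u A x = x \<and> flip v B y = y}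
    + card {d \<in> bent_params A B. flip_params A B u v d = d}
    + card {d \<in> bent_params B A. flip_params B A v u d = d}"
proof -
  let ?f = "\<lambda>S. box_sym A B (False, u, v) ` S"
  have "card {S \<in> plus_shape A B ` plus_params A B. ?f S = S} =
      card {d \<in> plus_params A B. (\<lambda>(x, y). (flip u A x, flip v B y)) d = d}"
  proof (rule card_fixed_image[OF inj_plus[OF assms]])
    fix d assume d: "d \<in> plus_params A B"
    obtain x y where xy: "d = (x, y)" by fastforce
    show "?f (plus_shape A B d) = plus_shape A B ((\<lambda>(x, y). (flip u A x, flip v B y)) d)
        \<and> (\<lambda>(x, y). (flip u A x, flip v B y)) d \<in> plus_params A B"
      using d unfolding xy box_sym_plus by (auto simp: plus_params_def flip_def)
  qed
  moreover have "{d \<in> plus_params A B. (\<lambda>(x, y). (flip u A x, flip v B y)) d = d} =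
      {(x, y) \<in> plus_params A B. flip u A x = x \<and> flip v B y = y}" by auto
  moreover have "card {S \<in> box_cross A B ` bent_params A B. ?f S = S} =
      card {d \<in> bent_params A B. flip_params A B u v d = d}"
    by (rule card_fixed_image[OF inj_box_cross]) (simp add: box_sym_cross flip_params_bent)
  moreover have "card {S \<in> (\<lambda>d. prod.swap ` box_cross B A d) ` bent_params B A. ?f S = S} =
      card {d \<in> bent_params B A. flip_params B A v u d = d}"
  proof (rule card_fixed_image)
    show "inj_on (\<lambda>d. prod.swap ` box_cross B A d) (bent_params B A)"
    proof (rule inj_onI)
      fix d e assume de: "d \<in> bent_params B A" "e \<in> bent_params B A" "prod.swap ` box_cross B A d = prod.swap ` box_cross B A e"
      then have "box_cross B A d = box_cross B A e" by (metis swap_swap_image)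
      then show "d = e" using inj_onD[OF inj_box_cross] de by blast
    qed
  qed (simp add: box_sym_swap box_sym_cross flip_params_bent)
  ultimately show ?thesis using card_fixed_shapes[OF assms] by simp
qed

text \<open>A symmetry exchanging the axes turns a bent cross with a full column into one with a
  full row, so it can fix only plus shapes.\<close>

lemma card_fixed_swap:
  assumes "1 \<le> A"
  shows "card {S \<in> shapes A A. box_sym A A (True, u, v) ` S = S} =
    card {(x, y) \<in> plus_params A A. flip u A y = x \<and> flip v A x = y}"
proof -
  let ?f = "\<lambda>S. box_sym A A (True, u, v) ` S"
  have "card {S \<in> plus_shape A A ` plus_params A A. ?f S = S} =
      card {d \<in> plus_params A A. (\<lambda>(x, y). (flip u A y, flip v A x)) d = d}"
  proof (rule card_fixed_image[OF inj_plus[OF assms assms]])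
    fix d assume d: "d \<in> plus_params A A"
    obtain x y where xy: "d = (x, y)" by fastforce
    show "?f (plus_shape A A d) = plus_shape A A ((\<lambda>(x, y). (flip u A y, flip v A x)) d)
        \<and> (\<lambda>(x, y). (flip u A y, flip v A x)) d \<in> plus_params A A"
      using d swap_plus[of x y A A] by (auto simp: xy box_sym_True box_sym_plus plus_params_def flip_def)
  qed
  moreover have "{d \<in> plus_params A A. (\<lambda>(x, y). (flip u A y, flip v A x)) d = d} =
      {(x, y) \<in> plus_params A A. flip u A y = x \<and> flip v A x = y}" by auto
  moreover have "card {S \<in> box_cross A A ` bent_params A A. ?f S = S} = 0"
  proof -
    have "box_sym A A (True, u, v) ` S \<noteq> S" if S: "S = box_cross A A d" "d \<in> bent_params A A" for S d
    proof
      assume "box_sym A A (True, u, v) ` S = S"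
      then have "prod.swap ` box_cross A A (flip_params A A v u d) = box_cross A A d"
        by (simp add: S box_sym_True box_sym_swap box_sym_cross)
      then show False using has_row_box_cross[OF S(2)] has_row_swap_box_cross[OF flip_params_bent[OF S(2)]] by metis
    qed
    then have "{S \<in> box_cross A A ` bent_params A A. ?f S = S} = {}" by blast
    then show ?thesis by (simp only: card.empty)
  qed
  moreover have "card {S \<in> (\<lambda>d. prod.swap ` box_cross A A d) ` bent_params A A. ?f S = S} = 0"
  proof -
    have "box_sym A A (True, u, v) ` S \<noteq> S" if S: "S = prod.swap ` box_cross A A d" "d \<in> bent_params A A" for S d
    proof
      assume "box_sym A A (True, u, v) ` S = S"
      then have "prod.swap ` box_cross A A d = box_cross A A (flip_params A A u v d)"
        by (simp add: S box_sym_True swap_swap_image box_sym_cross)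
      then show False using has_row_box_cross[OF flip_params_bent[OF S(2)]] has_row_swap_box_cross[OF S(2)] by metis
    qed
    then have "{S \<in> (\<lambda>d. prod.swap ` box_cross A A d) ` bent_params A A. ?f S = S} = {}" by blast
    then show ?thesis by (simp only: card.empty)
  qed
  ultimately show ?thesis using card_fixed_shapes[OF assms assms, of "\<lambda>S. ?f S = S"] by simp
qed

text \<open>The number of fixed points of the reflection \<open>A - x\<close> on
  \<open>{0..A}\<close> for \<open>0 \<le> A\<close>: the midpoint, if it is an integer.\<close>

definition evenness :: "int \<Rightarrow> int" where
  "evenness A = (if even A then 1 else 0)"

lemma card_flip_fixed:
  assumes "0 \<le> A"
  shows "int (card {x \<in> {0..A}. flip u A x = x}) = (if u then evenness A else A + 1)"
proof (cases u)
  case True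
  have "{x \<in> {0..A}. flip u A x = x} = (if even A then {A div 2} else {})"
    using assms True by (auto simp: flip_def)
  then show ?thesis using True by (simp add: evenness_def)
next
  case False
  then have "{x \<in> {0..A}. flip u A x = x} = {0..A}" by (auto simp: flip_def)
  then show ?thesis using False assms by simp
qed

lemma card_plus_fixed:
  assumes "0 \<le> A" "0 \<le> B"
  shows "int (card {(x, y) \<in> plus_params A B. flip u A x = x \<and> flip v B y = y}) =
    (if u then evenness A else A + 1) * (if v then evenness B else B + 1)"
proof -
  have "{(x, y) \<in> plus_params A B. flip u A x = x \<and> flip v B y = y} =
      {x \<in> {0..A}. flip u A x = x} \<times> {y \<in> {0..B}. flip v B y = y}"
    by (auto simp: plus_params_def)
  then show ?thesis
    using assms by (simp only: card_cartesian_product of_nat_mult card_flip_fixed)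
qed

text \<open>For \<open>u = v\<close> the symmetry is a diagonal reflection, with one fixed centre
  for each \<open>y\<close>; otherwise it is a quarter turn, and the centre must be that of the
  box.\<close>

lemma card_plus_swap_fixed:
  assumes "0 \<le> A"
  shows "int (card {(x, y) \<in> plus_params A A. flip u A y = x \<and> flip v A x = y}) =
    (if u = v then A + 1 else evenness A)"
proof -
  have "{(x, y) \<in> plus_params A A. flip u A y = x \<and> flip v A x = y} =
      (\<lambda>y. (flip u A y, y)) ` {y \<in> {0..A}. flip (u \<noteq> v) A y = y}"
    by (cases u; cases v) (auto simp: plus_params_def flip_def image_iff)
  moreover have "inj_on (\<lambda>y. (flip u A y, y)) X" for X by (auto simp: inj_on_def)
  ultimately show ?thesis
    using card_flip_fixed[OF assms, of "u \<noteq> v"] by (simp add: card_image)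
qed

text \<open>A half turn requires \<open>x\<close> to be the middle column and
  \<open>y' = B - y\<close>, where \<open>y \<noteq> y'\<close> excludes the midpoint. Either
  reflection alone forces \<open>y = y'\<close>, by exchanging the arms or by putting both in the
  middle. The identity leaves \<open>A - 1\<close> columns and ordered pairs of distinct
  heights.\<close>

lemma card_bent_fixed:
  assumes "1 \<le> A" "1 \<le> B"
  shows "int (card {d \<in> bent_params A B. flip_params A B u v d = d}) =
    (if u \<and> v then evenness A * (B + 1 - evenness B) else if u \<or> v then 0 else (A - 1) * (B * (B + 1)))"
proof -
  consider "u" "v" | "u" "\<not> v" | "\<not> u" "v" | "\<not> u" "\<not> v" by blast
  then show ?thesis
  proof cases
    case 1
    let ?M = "{y \<in> {0..B}. flip True B y = y}"
    have "{d \<in> bent_params A B. flip_params A B u v d = d} =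
        {x \<in> {0..A}. flip True A x = x} \<times> (\<lambda>y. (y, B - y)) ` ({0..B} - ?M)"
      using 1 assms by (auto simp: bent_params_def flip_params_def flip_def image_iff)
    moreover have "inj_on (\<lambda>y. (y, B - y)) X" for X by (auto simp: inj_on_def)
    moreover have "int (card ({0..B} - ?M)) = B + 1 - evenness B"
    proof -
      have "finite ?M" by (rule finite_subset[of _ "{0..B}"]) auto
      then have "card ({0..B} - ?M) = card {0..B} - card ?M" by (intro card_Diff_subset) auto
      moreover have "card ?M \<le> card {0..B}" by (intro card_mono) auto
      ultimately show ?thesis using card_flip_fixed[of B True] assms by simp
    qed
    ultimately show ?thesis
      using 1 card_flip_fixed[of A True] assms by (simp add: card_cartesian_product card_image)
  next
    case 2
    then have "{d \<in> bent_params A B. flip_params A B u v d = d} = {}"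
      by (auto simp: bent_params_def flip_params_def flip_def)
    then have "card {d \<in> bent_params A B. flip_params A B u v d = d} = 0" by (simp only: card.empty)
    then show ?thesis using 2 by simp
  next
    case 3
    then have "{d \<in> bent_params A B. flip_params A B u v d = d} = {}"
      by (auto simp: bent_params_def flip_params_def flip_def)
    then have "card {d \<in> bent_params A B. flip_params A B u v d = d} = 0" by (simp only: card.empty)
    then show ?thesis using 3 by simp
  next
    case 4
    let ?D = "(\<lambda>y. (y, y)) ` {0..B}"
    have "{d \<in> bent_params A B. flip_params A B u v d = d} = {0<..<A} \<times> ({0..B} \<times> {0..B} - ?D)"
      using 4 by (auto simp: bent_params_def flip_params_def flip_def)
    moreover have "int (card ({0..B} \<times> {0..B} - ?D)) = B * (B + 1)"
    proof -
      have D: "card ?D = card {0..B}" by (intro card_image) (auto simp: inj_on_def)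
      have "card ({0..B} \<times> {0..B} - ?D) = card ({0..B} \<times> {0..B}) - card ?D"
        by (intro card_Diff_subset) auto
      moreover have "card ?D \<le> card ({0..B} \<times> {0..B})" by (intro card_mono) auto
      ultimately have "int (card ({0..B} \<times> {0..B} - ?D)) = int (card {0..B} * card {0..B}) - int (card {0..B})"
        by (simp add: D card_cartesian_product)
      then show ?thesis using assms by (simp add: algebra_simps)
    qed
    ultimately show ?thesis
      using 4 assms by (simp add: card_cartesian_product)
  qed
qed

lemma sum_bool_pairs: "(\<Sum>i\<in>UNIV. f i) = f (False, False) + f (False, True) + f (True, False) + f (True, True)"
  for f :: "bool \<times> bool \<Rightarrow> int"
proof -
  have eq: "(UNIV :: (bool \<times> bool) set) = {(False, False), (False, True), (True, False), (True, True)}" by auto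
  show ?thesis unfolding eq by simp
qed

section \<open>Orbits under the symmetries of the box\<close>

definition orbit :: "int \<Rightarrow> int \<Rightarrow> cell set \<Rightarrow> cell set set" where
  "orbit A B S = (\<lambda>i. box_sym A B i ` S) ` box_syms A B"

lemma extremal_translate:
  assumes "extremal S" shows "extremal ((+) t ` S)"
proof -
  obtain a b c d where S: "spans S a b c d" using assms spans_exists by (metis extremal_def)
  have S': "spans ((+) t ` S) (fst t + a) (fst t + b) (snd t + c) (snd t + d)"
    using S by (cases t) (auto simp: spans_def image_image)
  have "card ((+) t ` S) = card S" by (intro card_image) auto
  moreover have "edge_connected ((+) t ` S)"
    using assms by (intro edge_connected_image) (auto simp: extremal_def edge_adjacent_def)
  ultimately show ?thesis
    using assms spans_dims[OF S] spans_dims[OF S'] unfolding extremal_def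
    by (simp add: corner_area_translate)
qed

lemma extremal_box_sym:
  assumes "extremal S" shows "extremal (box_sym A B i ` S)"
proof -
  obtain s u v where i: "i = (s, u, v)" by (cases i)
  define S1 where "S1 = (if s then prod.swap ` S else S)"
  define S2 where "S2 = (if u then negx ` S1 else S1)"
  \<comment> \<open>The vertical flip is the horizontal one conjugated by transposition; the shifts
    by \<open>A\<close> and \<open>B\<close> are added afterwards.\<close>
  define S3 where "S3 = (if v then prod.swap ` negx ` prod.swap ` S2 else S2)"
  have "extremal S3"
    using assms extremal_swap extremal_negx by (simp add: S1_def S2_def S3_def)
  moreover have "box_sym A B i ` S = (+) (if u then A else 0, if v then B else 0) ` S3"
    unfolding S3_def S2_def S1_def i
    by (cases s; cases u; cases v) (simp_all add: image_image negx_def, (force intro!: image_cong)+)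
  ultimately show ?thesis using extremal_translate by simp
qed

lemma shapes_closed:
  assumes "i \<in> box_syms A B" "S \<in> shapes A B"
  shows "box_sym A B i ` S \<in> shapes A B"
proof -
  obtain s u v where i: "i = (s, u, v)" by (cases i)
  have no_swap: "spans (box_sym A B (False, u, v) ` S) 0 A 0 B" if "spans S 0 A 0 B" for S
  proof -
    have "x \<in> fst ` box_sym A B (False, u, v) ` S" if "flip u A x \<in> fst ` S" for x
      using that by (force simp: image_image flip_def)
    moreover have "y \<in> snd ` box_sym A B (False, u, v) ` S" if "flip v B y \<in> snd ` S" for y
      using that by (force simp: image_image flip_def)
    ultimately show ?thesis
      using that unfolding spans_def by (auto simp: flip_def simp del: image_iff)
  qed
  have "spans (box_sym A B i ` S) 0 A 0 B"
  proof (cases s)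
    case True
    then have "A = B" using assms(1) by (auto simp: box_syms_def i split: if_splits)
    then show ?thesis
      using assms(2) True no_swap[of "prod.swap ` S"] spans_swap[of S 0 A 0 B] unfolding i
      by (simp only: box_sym_True shapes_def) simp
  next
    case False
    then show ?thesis using assms(2) no_swap[of S] by (simp add: i shapes_def)
  qed
  then show ?thesis using assms(2) extremal_box_sym by (simp add: shapes_def)
qed

lemma orbit_count:
  assumes "0 \<le> A" "0 \<le> B"
  shows "card (box_syms A B) * card (orbit A B ` shapes A B) =
      (\<Sum>i\<in>box_syms A B. card {S \<in> shapes A B. box_sym A B i ` S = S})"
    and "S \<in> shapes A B \<Longrightarrow> T \<in> shapes A B \<Longrightarrow> orbit A B S = orbit A B T \<longleftrightarrow> T \<in> orbit A B S"
proof -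
  have fin: "finite (box_syms A B)" by (simp add: box_syms_def)
  have unit: "(False, False, False) \<in> box_syms A B" by (simp add: box_syms_def)
  have id: "box_sym A B (False, False, False) ` S = S" for S
  proof -
    have "box_sym A B (False, False, False) c = c" for c by (cases c) simp
    then show ?thesis by simp
  qed
  have comp: "\<exists>\<pi>. bij_betw \<pi> (box_syms A B) (box_syms A B) \<and>
     (\<forall>i\<in>box_syms A B. \<forall>S\<in>shapes A B. box_sym A B (\<pi> i) ` S = box_sym A B i ` box_sym A B j ` S)"
    if "j \<in> box_syms A B" for j
  proof -
    from box_sym_comp[OF that] obtain \<pi> where \<pi>: "bij_betw \<pi> (box_syms A B) (box_syms A B)"
      "\<forall>i\<in>box_syms A B. \<forall>c. box_sym A B (\<pi> i) c = box_sym A B i (box_sym A B j c)"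
      by blast
    have "box_sym A B (\<pi> i) ` S = box_sym A B i ` box_sym A B j ` S" if "i \<in> box_syms A B" for i S
      unfolding image_image using \<pi>(2) that by (intro image_cong) auto
    then show ?thesis using \<pi>(1) by blast
  qed
  note b = burnside_orbit_count[where act = "\<lambda>i S. box_sym A B i ` S", OF fin finite_shapes[OF assms]
      shapes_closed unit id comp]
  show "card (box_syms A B) * card (orbit A B ` shapes A B) =
      (\<Sum>i\<in>box_syms A B. card {S \<in> shapes A B. box_sym A B i ` S = S})"
    using b(1) unfolding orbit_def[abs_def] by blast
  show "S \<in> shapes A B \<Longrightarrow> T \<in> shapes A B \<Longrightarrow> orbit A B S = orbit A B T \<longleftrightarrow> T \<in> orbit A B S"
    using b(2) unfolding orbit_def[abs_def] by blast
qed

text \<open>The first line comes from the identity. Then follow the two reflections and the half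
  turn on plus shapes, and the half turn on the two bent families.\<close>

lemma orbit_number_rectangle:
  assumes "1 \<le> A" "1 \<le> B" "A \<noteq> B"
  shows "4 * int (card (orbit A B ` shapes A B)) =
    (A + 1) * (B + 1) + (A - 1) * (B * (B + 1)) + (B - 1) * (A * (A + 1))
    + evenness A * (B + 1) + evenness B * (A + 1) + evenness A * evenness B + evenness A * (B + 1 - evenness B) + evenness B * (A + 1 - evenness A)"
proof -
  have I: "box_syms A B = Pair False ` UNIV" using assms by (auto simp: box_syms_def)
  have "card (box_syms A B) = 4" by (simp add: I card_image inj_on_def card_cartesian_product flip: UNIV_Times_UNIV)
  moreover have "int (\<Sum>i\<in>box_syms A B. card {S \<in> shapes A B. box_sym A B i ` S = S}) =
      (\<Sum>i\<in>UNIV. int (card {S \<in> shapes A B. box_sym A B (False, i) ` S = S}))"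
    unfolding I by (subst sum.reindex) (auto simp: inj_on_def)
  moreover have "card (box_syms A B) * card (orbit A B ` shapes A B) =
      (\<Sum>i\<in>box_syms A B. card {S \<in> shapes A B. box_sym A B i ` S = S})"
    using orbit_count(1)[of A B] assms by simp
  then have "int (card (box_syms A B)) * int (card (orbit A B ` shapes A B)) =
      int (\<Sum>i\<in>box_syms A B. card {S \<in> shapes A B. box_sym A B i ` S = S})"
    by (metis of_nat_mult)
  ultimately have "4 * int (card (orbit A B ` shapes A B)) =
      (\<Sum>i\<in>UNIV. int (card {S \<in> shapes A B. box_sym A B (False, i) ` S = S}))"
    by simp
  then show ?thesis
    using assms by (simp add: sum_bool_pairs card_fixed_no_swap card_plus_fixed card_bent_fixed algebra_simps)
qed

text \<open>The term \<open>2 * (A + 1)\<close> comes from the two diagonal reflections and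
  \<open>2 * evenness A\<close> from the two quarter turns; the rest is the rectangular count for
  \<open>A = B\<close>.\<close>

lemma orbit_number_square:
  assumes "1 \<le> A"
  shows "8 * int (card (orbit A A ` shapes A A)) =
    (A + 1) * (A + 1) + 2 * ((A - 1) * (A * (A + 1)))
    + 2 * (evenness A * (A + 1)) + evenness A * evenness A + 2 * (evenness A * (A + 1 - evenness A)) + 2 * (A + 1) + 2 * evenness A"
proof -
  have I: "box_syms A A = Pair False ` UNIV \<union> Pair True ` UNIV" by (auto simp: box_syms_def)
  have "card (box_syms A A) = 8" by (simp add: box_syms_def card_cartesian_product flip: UNIV_Times_UNIV)
  moreover have "int (\<Sum>i\<in>box_syms A A. card {S \<in> shapes A A. box_sym A A i ` S = S}) =
      (\<Sum>i\<in>UNIV. int (card {S \<in> shapes A A. box_sym A A (False, i) ` S = S})) +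
      (\<Sum>i\<in>UNIV. int (card {S \<in> shapes A A. box_sym A A (True, i) ` S = S}))"
  proof -
    have "Pair False ` UNIV \<inter> Pair True ` (UNIV :: (bool \<times> bool) set) = {}" by auto
    then show ?thesis unfolding I by (simp add: sum.union_disjoint sum.reindex inj_on_def)
  qed
  moreover have "card (box_syms A A) * card (orbit A A ` shapes A A) =
      (\<Sum>i\<in>box_syms A A. card {S \<in> shapes A A. box_sym A A i ` S = S})"
    using orbit_count(1)[of A A] assms by simp
  then have "int (card (box_syms A A)) * int (card (orbit A A ` shapes A A)) =
      int (\<Sum>i\<in>box_syms A A. card {S \<in> shapes A A. box_sym A A i ` S = S})"
    by (metis of_nat_mult)
  ultimately have "8 * int (card (orbit A A ` shapes A A)) =
      (\<Sum>i\<in>UNIV. int (card {S \<in> shapes A A. box_sym A A (False, i) ` S = S})) +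
      (\<Sum>i\<in>UNIV. int (card {S \<in> shapes A A. box_sym A A (True, i) ` S = S}))"
    by simp
  then show ?thesis
    using assms by (simp add: sum_bool_pairs card_fixed_no_swap card_fixed_swap card_plus_fixed card_bent_fixed
        card_plus_swap_fixed algebra_simps)
qed

section \<open>Congruence\<close>

fun turn :: "bool \<times> bool \<times> bool \<Rightarrow> real \<times> real \<Rightarrow> real \<times> real" where
  "turn (s, u, v) (x, y) =
     (if u then - (if s then y else x) else (if s then y else x),
      if v then - (if s then x else y) else (if s then x else y))"

text \<open>The inverse of \<open>turn\<close>: the signs are undone before the coordinates are
  exchanged back.\<close>

fun turn_back :: "bool \<times> bool \<times> bool \<Rightarrow> real \<times> real \<Rightarrow> real \<times> real" where
  "turn_back (s, u, v) (x, y) =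
     (if s then (if v then - y else y, if u then - x else x)
      else (if u then - x else x, if v then - y else y))"

definition motion :: "cell \<Rightarrow> bool \<times> bool \<times> bool \<Rightarrow> real \<times> real \<Rightarrow> real \<times> real" where
  "motion t i p = corner t + turn i p"

lemma mem_motion_image: "z \<in> motion t i ` U \<longleftrightarrow> turn_back i (z - corner t) \<in> U"
proof -
  obtain s u v where i: "i = (s, u, v)" by (cases i)
  have "turn i (turn_back i w) = w" for w unfolding i by (cases w) auto
  then have "motion t i (turn_back i (z - corner t)) = z" by (simp add: motion_def)
  moreover have "turn_back i (motion t i p - corner t) = p" for p
    unfolding i by (cases p) (auto simp: motion_def)
  ultimately show ?thesis by (metis imageE imageI)
qed

text \<open>Negating a coordinate makes the opposite side of the square the lower one, so the corner
  has to be corrected by one in each flipped direction.\<close>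

lemma motion_unit_square:
  "motion t (s, u, v) ` unit_square c = unit_square (t + box_sym 0 0 (s, u, v) c - (of_bool u, of_bool v))"
proof (rule set_eqI)
  fix z :: "real \<times> real"
  obtain a b where z: "z = (a, b)" by fastforce
  obtain x y where c: "c = (x, y)" by fastforce
  obtain p q where t: "t = (p, q)" by fastforce
  show "z \<in> motion t (s, u, v) ` unit_square c \<longleftrightarrow>
      z \<in> unit_square (t + box_sym 0 0 (s, u, v) c - (of_bool u, of_bool v))"
    unfolding mem_motion_image z c t
    by (cases s; cases u; cases v) (auto simp: unit_square_def)
qed

lemma grid_isometry_motion: "grid_isometry (motion t i)"
proof -
  obtain s u v where i: "i = (s, u, v)" by (cases i)
  have "dist (motion t i p) (motion t i q) = dist p q" for p q
    unfolding i by (cases p; cases q; cases s; cases u; cases v)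
      (auto simp: motion_def dist_prod_def dist_real_def power2_commute abs_minus_commute add.commute)
  moreover have "z \<in> motion t i ` (\<int> \<times> \<int>) \<longleftrightarrow> z \<in> \<int> \<times> \<int>" for z
    unfolding mem_motion_image i
    by (cases z; cases t; cases s; cases u; cases v)
      (auto simp: minus_in_Ints_iff diff_in_Ints_iff_right diff_in_Ints_iff_left)
  ultimately show ?thesis unfolding grid_isometry_def by blast
qed

lemma int_unit_vector:
  fixes a b :: int
  assumes "a\<^sup>2 + b\<^sup>2 = 1"
  shows "(a = 1 \<or> a = - 1) \<and> b = 0 \<or> a = 0 \<and> (b = 1 \<or> b = - 1)"
proof -
  have "a\<^sup>2 \<le> 1" using assms zero_le_power2[of b] by linarith
  then have "\<bar>a\<bar> \<le> 1" by (simp add: abs_square_le_1)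
  then consider "a = 0" | "a = 1 \<or> a = - 1" by linarith
  then show ?thesis
    using assms by cases (auto simp: power2_eq_1_iff)
qed

text \<open>The origin and the two unit points go to grid points, so the linear part is given by two
  orthogonal integer unit vectors; the distances to these three images determine every other
  value.\<close>

lemma grid_isometry_is_motion:
  assumes "grid_isometry f"
  obtains t i where "f = motion t i"
proof -
  have dist: "dist (f p) (f q) = dist p q" for p q
    using assms unfolding grid_isometry_def by blast
  have D: "(fst (f p) - fst (f q))\<^sup>2 + (snd (f p) - snd (f q))\<^sup>2 = (fst p - fst q)\<^sup>2 + (snd p - snd q)\<^sup>2" for p q
    using dist[of p q] by (simp add: dist_prod_def dist_real_def)
  have "f p \<in> \<int> \<times> \<int>" if "p \<in> \<int> \<times> \<int>" for p
    using assms that unfolding grid_isometry_def by blast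
  moreover have "\<exists>c. z = corner c" if z: "z \<in> \<int> \<times> \<int>" for z
  proof -
    obtain x y where "z = (x, y)" "x \<in> \<int>" "y \<in> \<int>" using z by blast
    then obtain m n where "z = corner (m, n)" by (auto elim!: Ints_cases)
    then show ?thesis by blast
  qed
  ultimately have int: "\<exists>c. f p = corner c" if "p \<in> \<int> \<times> \<int>" for p using that by blast
  obtain t1 t2 where t: "f (0, 0) = corner (t1, t2)" using int[of "(0, 0)"] by auto
  obtain p1 p2 where p: "f (1, 0) = corner (p1, p2)" using int[of "(1, 0)"] by auto
  obtain q1 q2 where q: "f (0, 1) = corner (q1, q2)" using int[of "(0, 1)"] by auto
  define a1 a2 b1 b2 where "a1 = p1 - t1" and "a2 = p2 - t2" and "b1 = q1 - t1" and "b2 = q2 - t2"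
  note ab = a1_def a2_def b1_def b2_def
  have A: "(of_int a1)\<^sup>2 + (of_int a2)\<^sup>2 = (1::real)"
    using D[of "(1, 0)" "(0, 0)"] by (simp add: t p ab)
  have B: "(of_int b1)\<^sup>2 + (of_int b2)\<^sup>2 = (1::real)"
    using D[of "(0, 1)" "(0, 0)"] by (simp add: t q ab)
  have AB: "(of_int a1 - of_int b1)\<^sup>2 + (of_int a2 - of_int b2)\<^sup>2 = (2::real)"
    using D[of "(1, 0)" "(0, 1)"] by (simp add: p q ab)
  have "real_of_int (a1\<^sup>2 + a2\<^sup>2) = real_of_int 1" "real_of_int (b1\<^sup>2 + b2\<^sup>2) = real_of_int 1"
    using A B by simp_all
  then have unit: "a1\<^sup>2 + a2\<^sup>2 = 1" "b1\<^sup>2 + b2\<^sup>2 = 1" by (simp_all only: of_int_eq_iff)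
  \<comment> \<open>The axes are exchanged iff the first unit vector has \<open>a1 = 0\<close>.
    Exactly one of \<open>a1\<close> and \<open>b1\<close> is nonzero, so their sum is the sign in
    the first coordinate; likewise \<open>a2 + b2\<close> in the second.\<close>
  have "f (x, y) = motion (t1, t2) (a1 = 0, a1 + b1 = - 1, a2 + b2 = - 1) (x, y)" for x y
  proof -
    define X Y where "X = fst (f (x, y)) - of_int t1" and "Y = snd (f (x, y)) - of_int t2"
    have 0: "X\<^sup>2 + Y\<^sup>2 = x\<^sup>2 + y\<^sup>2"
      using D[of "(x, y)" "(0, 0)"] by (simp add: t X_def Y_def)
    have 1: "(X - of_int a1)\<^sup>2 + (Y - of_int a2)\<^sup>2 = (x - 1)\<^sup>2 + y\<^sup>2"
      using D[of "(x, y)" "(1, 0)"] by (simp add: p X_def Y_def ab)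
    have 2: "(X - of_int b1)\<^sup>2 + (Y - of_int b2)\<^sup>2 = x\<^sup>2 + (y - 1)\<^sup>2"
      using D[of "(x, y)" "(0, 1)"] by (simp add: q X_def Y_def ab)
    \<comment> \<open>Subtracting two squared distances leaves the inner product with the image of a
      unit vector.\<close>
    have x: "X * of_int a1 + Y * of_int a2 = x" using 0 1 A by (simp add: power2_diff)
    have y: "X * of_int b1 + Y * of_int b2 = y" using 0 2 B by (simp add: power2_diff)
    have f: "f (x, y) = (of_int t1 + X, of_int t2 + Y)" by (simp add: X_def Y_def prod_eq_iff)
    show ?thesis
      using int_unit_vector[OF unit(1)] int_unit_vector[OF unit(2)] AB x y unfolding f motion_def
      by auto
  qed
  then have "f = motion (t1, t2) (a1 = 0, a1 + b1 = - 1, a2 + b2 = - 1)" by auto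
  then show ?thesis using that by blast
qed

text \<open>The centre of a cell lies in no other closed unit square of the grid, so the region
  determines the cells.\<close>

lemma region_inject: "region P = region Q \<longleftrightarrow> P = Q"
proof -
  have mem: "c \<in> P \<longleftrightarrow> (of_int (fst c) + 1 / 2, of_int (snd c) + 1 / 2) \<in> region P" for c P
  proof
    assume "(of_int (fst c) + 1 / 2, of_int (snd c) + 1 / 2) \<in> region P"
    then obtain d where d: "d \<in> P" "(of_int (fst c) + 1 / 2, of_int (snd c) + 1 / 2) \<in> unit_square d"
      by (auto simp: region_def)
    then have "c = d" unfolding unit_square_def by (auto simp: prod_eq_iff)
    then show "c \<in> P" using d by simp
  qed (auto simp: region_def unit_square_def intro!: bexI[of _ c])
  then show ?thesis by blast
qed

lemma motion_region:
  "motion t (s, u, v) ` region P = region ((+) (t - (of_bool u, of_bool v)) ` box_sym 0 0 (s, u, v) ` P)"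
  by (simp add: region_def image_UN motion_unit_square image_image algebra_simps)

lemma congruence_iff: "(P, Q) \<in> congruence \<longleftrightarrow> (\<exists>t i. Q = (+) t ` box_sym 0 0 i ` P)"
proof
  assume "(P, Q) \<in> congruence"
  then obtain f where f: "grid_isometry f" "f ` region P = region Q" by (auto simp: congruence_def)
  obtain t i where ti: "f = motion t i" using grid_isometry_is_motion f by blast
  obtain s u v where i: "i = (s, u, v)" by (cases i)
  show "\<exists>t i. Q = (+) t ` box_sym 0 0 i ` P"
    using f(2) unfolding ti i motion_region region_inject by blast
next
  assume "\<exists>t i. Q = (+) t ` box_sym 0 0 i ` P"
  then obtain t i where ti: "Q = (+) t ` box_sym 0 0 i ` P" by blast
  obtain s u v where i: "i = (s, u, v)" by (cases i)
  have "motion (t + (of_bool u, of_bool v)) i ` region P = region Q"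
    unfolding ti i motion_region by simp
  then show "(P, Q) \<in> congruence"
    using grid_isometry_motion unfolding congruence_def by blast
qed

lemma box_sym_0_add: "box_sym 0 0 i (t + c) = box_sym 0 0 i t + box_sym 0 0 i c"
  by (cases i; cases t; cases c) simp

text \<open>For \<open>A = B = 0\<close> the box symmetries are the eight linear ones, so their
  composition rule serves as group law; an inverse of \<open>j\<close> exists because
  \<open>\<pi>\<close> is onto.\<close>

lemma congruence_class_eq: "congruence `` {P} = congruence `` {Q} \<longleftrightarrow> (P, Q) \<in> congruence"
proof -
  have univ: "box_syms 0 0 = UNIV" by (simp add: box_syms_def)
  have id: "box_sym 0 0 (False, False, False) c = c" for c by (cases c) simp
  have refl: "(P, P) \<in> congruence" for P
  proof -
    have "P = (+) 0 ` box_sym 0 0 (False, False, False) ` P" using id by simp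
    then show ?thesis unfolding congruence_iff by blast
  qed
  have trans: "(P, R) \<in> congruence" if PQ: "(P, Q) \<in> congruence" "(Q, R) \<in> congruence" for P Q R
  proof -
    obtain t j t' i where *: "Q = (+) t ` box_sym 0 0 j ` P" "R = (+) t' ` box_sym 0 0 i ` Q"
      using PQ unfolding congruence_iff by blast
    obtain \<pi> where "\<forall>i c. box_sym 0 0 (\<pi> i) c = box_sym 0 0 i (box_sym 0 0 j c)"
      using box_sym_comp[of j 0 0] univ by auto
    then have "box_sym 0 0 (\<pi> i) c = box_sym 0 0 i (box_sym 0 0 j c)" for c by blast
    then have "R = (+) (t' + box_sym 0 0 i t) ` box_sym 0 0 (\<pi> i) ` P"
      unfolding * image_image box_sym_0_add by (intro image_cong) (simp_all add: add.assoc)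
    then show ?thesis unfolding congruence_iff by blast
  qed
  have sym: "(Q, P) \<in> congruence" if PQ: "(P, Q) \<in> congruence" for P Q
  proof -
    obtain t j where *: "Q = (+) t ` box_sym 0 0 j ` P" using PQ unfolding congruence_iff by blast
    obtain \<pi> where \<pi>: "bij \<pi>" "\<forall>i c. box_sym 0 0 (\<pi> i) c = box_sym 0 0 i (box_sym 0 0 j c)"
      using box_sym_comp[of j 0 0] univ by auto
    obtain i where "\<pi> i = (False, False, False)" using \<pi>(1) by (metis bij_pointE)
    then have "box_sym 0 0 i (box_sym 0 0 j c) = c" for c using \<pi>(2) id by metis
    then have "P = (+) (- box_sym 0 0 i t) ` box_sym 0 0 i ` Q"
      unfolding * image_image box_sym_0_add by simp
    then show ?thesis unfolding congruence_iff by blast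
  qed
  show ?thesis using refl sym trans by blast
qed

section \<open>Congruence of shapes in the same box\<close>

lemma spans_translate: "spans S a b c d \<Longrightarrow> spans ((+) t ` S) (fst t + a) (fst t + b) (snd t + c) (snd t + d)"
  by (cases t) (auto simp: spans_def image_image)

lemma spans_box_sym_0:
  assumes "spans S 0 A 0 B"
  shows "spans (box_sym 0 0 (False, u, v) ` S) (if u then - A else 0) (if u then 0 else A)
    (if v then - B else 0) (if v then 0 else B)"
proof -
  have "fst ` box_sym 0 0 (False, u, v) ` S = (\<lambda>x. if u then - x else x) ` fst ` S"
    "snd ` box_sym 0 0 (False, u, v) ` S = (\<lambda>x. if v then - x else x) ` snd ` S"
    unfolding image_image by (auto intro!: image_cong)
  then show ?thesis
    using assms unfolding spans_def by (cases u; cases v) (auto simp: image_iff)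
qed

lemma box_sym_translate:
  "box_sym A B (s, u, v) ` S = (+) (if u then A else 0, if v then B else 0) ` box_sym 0 0 (s, u, v) ` S"
  unfolding image_image by (intro image_cong) auto

text \<open>Both boxes are \<open>{0..A} \<times> {0..B}\<close>. Comparing them determines the
  translation from the flips and permits an exchange of the axes only for
  \<open>A = B\<close>.\<close>

lemma congruent_shapes_iff:
  assumes S: "S \<in> shapes A B" and T: "T \<in> shapes A B"
  shows "(S, T) \<in> congruence \<longleftrightarrow> T \<in> orbit A B S"
proof
  assume "(S, T) \<in> congruence"
  then obtain t i where ti: "T = (+) t ` box_sym 0 0 i ` S" unfolding congruence_iff by blast
  obtain s u v where i: "i = (s, u, v)" by (cases i)
  define S' A' B' where "S' = (if s then prod.swap ` S else S)" and "A' = (if s then B else A)"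
    and "B' = (if s then A else B)"
  have spS: "spans S 0 A 0 B" and spT: "spans T 0 A 0 B" using S T by (auto simp: shapes_def)
  then have "spans S' 0 A' 0 B'" using spans_swap by (auto simp: S'_def A'_def B'_def)
  moreover have "T = (+) t ` box_sym 0 0 (False, u, v) ` S'"
    by (simp add: ti i S'_def box_sym_True)
  ultimately have spT': "spans T (fst t + (if u then - A' else 0)) (fst t + (if u then 0 else A'))
    (snd t + (if v then - B' else 0)) (snd t + (if v then 0 else B'))"
    using spans_translate spans_box_sym_0 by simp
  note u = spans_unique[OF spT spT']
  have "A' = A" "B' = B" using u by (auto split: if_splits)
  then have t: "t = (if u then A else 0, if v then B else 0)" and "s \<longrightarrow> A = B"
    using u by (auto simp: A'_def prod_eq_iff split: if_splits)
  then have "i \<in> box_syms A B" by (auto simp: box_syms_def i)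
  moreover have "T = box_sym A B i ` S" unfolding ti i box_sym_translate[of A B] t ..
  ultimately show "T \<in> orbit A B S" by (auto simp: orbit_def)
next
  assume "T \<in> orbit A B S"
  then obtain i where i: "T = box_sym A B i ` S" by (auto simp: orbit_def)
  obtain s u v where "i = (s, u, v)" by (cases i)
  then show "(S, T) \<in> congruence" using i box_sym_translate congruence_iff by metis
qed

text \<open>Every maximal polyomino can be translated to the origin and, if its box is turned,
  transposed, so each congruence class meets \<open>shapes A B\<close>.\<close>

lemma c2_eq_orbit_number:
  assumes "1 \<le> n"
  defines "A \<equiv> int ((n - 1) div 2)" and "B \<equiv> int (n div 2)"
  shows "c2 n = card (orbit A B ` shapes A B)"
proof -
  let ?cl = "\<lambda>P. congruence `` {P}"
  have AB: "0 \<le> A" "0 \<le> B" by (simp_all add: A_def B_def)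
  have max: "P \<in> max_hull_polyominoes n \<longleftrightarrow>
      extremal P \<and> (width P = A \<and> height P = B \<or> width P = B \<and> height P = A)" for P
    using max_hull_iff(1)[OF assms(1)] by (simp add: A_def B_def)
  have "?cl ` max_hull_polyominoes n = ?cl ` shapes A B"
  proof (intro equalityI image_subsetI)
    fix P assume P: "P \<in> max_hull_polyominoes n"
    then have ext: "extremal P" using max by blast
    then obtain a b c d where sp: "spans P a b c d" using spans_exists by (metis extremal_def)
    let ?T = "(+) (- a, - c) ` P"
    have T: "extremal ?T" "spans ?T 0 (b - a) 0 (d - c)"
      using extremal_translate[OF ext] spans_translate[OF sp, of "(- a, - c)"] by auto
    have "\<exists>S\<in>shapes A B. (P, S) \<in> congruence"
    proof (cases "width P = A \<and> height P = B")
      case True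
      have id: "box_sym 0 0 (False, False, False) c = c" for c by (cases c) simp
      then have "?T = (+) (- a, - c) ` box_sym 0 0 (False, False, False) ` P" by simp
      then have "(P, ?T) \<in> congruence" unfolding congruence_iff by blast
      moreover have "?T \<in> shapes A B" using T True spans_dims[OF sp] by (simp add: shapes_def)
      ultimately show ?thesis by blast
    next
      case False
      then have wh: "width P = B" "height P = A" using P max by auto
      have "prod.swap ` ?T = (+) (- c, - a) ` box_sym 0 0 (True, False, False) ` P"
        unfolding image_image by (intro image_cong) auto
      then have "(P, prod.swap ` ?T) \<in> congruence" unfolding congruence_iff by blast
      moreover have "?T \<in> shapes B A" using T wh spans_dims[OF sp] by (simp add: shapes_def)
      then have "prod.swap ` ?T \<in> shapes A B" using shapes_swap by blast
      ultimately show ?thesis by blast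
    qed
    then show "?cl P \<in> ?cl ` shapes A B" using congruence_class_eq by blast
  next
    fix S assume "S \<in> shapes A B"
    then have "S \<in> max_hull_polyominoes n" using max spans_dims by (auto simp: shapes_def)
    then show "?cl S \<in> ?cl ` max_hull_polyominoes n" by blast
  qed
  moreover have "max_hull_polyominoes n // congruence = ?cl ` max_hull_polyominoes n"
    by (auto simp: quotient_def)
  moreover have "card (?cl ` shapes A B) = card (orbit A B ` shapes A B)"
    by (rule card_image_eq_card_image)
      (simp add: congruence_class_eq congruent_shapes_iff orbit_count(2)[OF AB])
  ultimately show ?thesis by (simp add: c2_def)
qed

section \<open>Evaluation by residues modulo 4\<close>

lemma shapes_thin: "0 \<le> B \<Longrightarrow> shapes 0 B = {{0} \<times> {0..B}}"
proof -
  assume B: "0 \<le> B"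
  have "plus_shape 0 B d = {0} \<times> {0..B}" if "d \<in> plus_params 0 B" for d
    using that by (auto simp: plus_shape_def cross_def plus_params_def)
  then have "plus_shape 0 B ` plus_params 0 B = (\<lambda>_. {0} \<times> {0..B}) ` plus_params 0 B"
    by (rule image_cong[OF refl])
  also have "\<dots> = {{0} \<times> {0..B}}"
    using B by (intro image_constant[of "(0, 0)"]) (simp add: plus_params_def)
  finally have "plus_shape 0 B ` plus_params 0 B = {{0} \<times> {0..B}}" .
  moreover have "bent_params 0 B = {}" "bent_params B 0 = {}" by (auto simp: bent_params_def)
  ultimately show ?thesis using B by (simp add: shapes_eq)
qed

text \<open>Odd \<open>n\<close> gives a square box, even \<open>n\<close> one whose sides differ by
  one; the residue modulo 4 decides which sides are even. Apart from the smallest \<open>n\<close>,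
  each case is a polynomial identity in \<open>q = n div 4\<close>.\<close>

lemma c2_formula:
  fixes n :: nat
  assumes "n \<ge> 1"
  shows "real (c2 n) =
           (if n mod 4 = 0 then (real n ^ 3 - 2 * real n ^ 2 + 4 * real n) / 16
            else if n mod 4 = 1 then (real n ^ 3 - 2 * real n ^ 2 + 13 * real n + 20) / 32
            else if n mod 4 = 2 then (real n ^ 3 - 2 * real n ^ 2 + 4 * real n + 8) / 16
            else (real n ^ 3 - 2 * real n ^ 2 + 5 * real n + 8) / 32)"
proof -
  define A B where "A = int ((n - 1) div 2)" and "B = int (n div 2)"
  define N where "N = card (orbit A B ` shapes A B)"
  have c2: "c2 n = N" using c2_eq_orbit_number[OF assms] by (simp add: A_def B_def N_def)
  show ?thesis
  proof (cases "n \<le> 2")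
    case True
    then have "A = 0" "B \<ge> 0" by (auto simp: A_def B_def)
    \<comment> \<open>The box has width 0 and all plus parameters describe the same column, so
      injectivity may fail and the only shape is counted directly.\<close>
    then have "N = 1" by (simp add: N_def shapes_thin)
    moreover have "n = 1 \<or> n = 2" using True assms by auto
    ultimately show ?thesis using c2 by auto
  next
    case False
    define q :: real where "q = real (n div 4)"
    have AB: "1 \<le> A" "1 \<le> B" using False by (auto simp: A_def B_def)
    have rect: "4 * real N = of_int ((A + 1) * (B + 1) + (A - 1) * (B * (B + 1)) + (B - 1) * (A * (A + 1))
        + evenness A * (B + 1) + evenness B * (A + 1) + evenness A * evenness B + evenness A * (B + 1 - evenness B) + evenness B * (A + 1 - evenness A))"
      if "A \<noteq> B"
      using orbit_number_rectangle[OF AB that] unfolding N_def by (metis of_int_mult of_int_numeral of_int_of_nat_eq)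
    have sq: "8 * real N = of_int ((A + 1) * (A + 1) + 2 * ((A - 1) * (A * (A + 1)))
        + 2 * (evenness A * (A + 1)) + evenness A * evenness A + 2 * (evenness A * (A + 1 - evenness A)) + 2 * (A + 1) + 2 * evenness A)"
      if "A = B"
      using orbit_number_square[OF AB(1)] unfolding N_def that[symmetric] by (metis of_int_mult of_int_numeral of_int_of_nat_eq)
    have "n mod 4 < 4" by simp
    then consider "n mod 4 = 0" | "n mod 4 = 1" | "n mod 4 = 2" | "n mod 4 = 3" by linarith
    then show ?thesis
    proof cases
      case 1
      then have "n = 4 * (n div 4)" by presburger
      then have n: "real n = 4 * q" unfolding q_def by (metis of_nat_mult of_nat_numeral)
      have eq: "A = 2 * int (n div 4) - 1" "B = 2 * int (n div 4)" "odd A" "even B"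
        using 1 assms unfolding A_def B_def by presburger+
      then have "of_int A = 2 * q - 1" "of_int B = 2 * q" by (simp_all add: q_def)
      then have "4 * real N = 16 * q ^ 3 - 8 * q ^ 2 + 4 * q"
        using rect eq by (simp add: evenness_def power2_eq_square power3_eq_cube algebra_simps)
      then show ?thesis using 1 by (simp add: c2 n power2_eq_square power3_eq_cube)
    next
      case 2
      then have "n = 4 * (n div 4) + 1" by presburger
      then have n: "real n = 4 * q + 1" unfolding q_def by (metis of_nat_add of_nat_mult of_nat_numeral of_nat_1)
      have eq: "A = 2 * int (n div 4)" "A = B" "even A"
        using 2 unfolding A_def B_def by presburger+
      then have "of_int A = 2 * q" by (simp_all add: q_def)
      then have "8 * real N = 16 * q ^ 3 + 4 * q ^ 2 + 12 * q + 8"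
        using sq eq by (simp add: evenness_def power2_eq_square power3_eq_cube algebra_simps)
      then show ?thesis using 2 by (simp add: c2 n power2_eq_square power3_eq_cube algebra_simps)
    next
      case 3
      then have "n = 4 * (n div 4) + 2" by presburger
      then have n: "real n = 4 * q + 2" unfolding q_def by (metis of_nat_add of_nat_mult of_nat_numeral)
      have eq: "A = 2 * int (n div 4)" "B = 2 * int (n div 4) + 1" "even A" "odd B"
        using 3 unfolding A_def B_def by presburger+
      then have "of_int A = 2 * q" "of_int B = 2 * q + 1" by (simp_all add: q_def)
      then have "4 * real N = 16 * q ^ 3 + 16 * q ^ 2 + 8 * q + 4"
        using rect eq by (simp add: evenness_def power2_eq_square power3_eq_cube algebra_simps)
      then show ?thesis using 3 by (simp add: c2 n power2_eq_square power3_eq_cube algebra_simps)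
    next
      case 4
      then have "n = 4 * (n div 4) + 3" by presburger
      then have n: "real n = 4 * q + 3" unfolding q_def by (metis of_nat_add of_nat_mult of_nat_numeral)
      have eq: "A = 2 * int (n div 4) + 1" "A = B" "odd A"
        using 4 unfolding A_def B_def by presburger+
      then have "of_int A = 2 * q + 1" by (simp_all add: q_def)
      then have "8 * real N = 16 * q ^ 3 + 28 * q ^ 2 + 20 * q + 8"
        using sq eq by (simp add: evenness_def power2_eq_square power3_eq_cube algebra_simps)
      then show ?thesis using 4 by (simp add: c2 n power2_eq_square power3_eq_cube algebra_simps)
    qed
  qed
qed

theorem theorem1:
  fixes n :: nat
  assumes "n \<ge> 1"
  shows "(\<forall>P\<in>max_hull_polyominoes n.
            hull_area P = real n + 1 / 2 * real ((n - 1) div 2) * real (n div 2)) \<and>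
         real (c2 n) =
           (if n mod 4 = 0 then (real n ^ 3 - 2 * real n ^ 2 + 4 * real n) / 16
            else if n mod 4 = 1 then (real n ^ 3 - 2 * real n ^ 2 + 13 * real n + 20) / 32
            else if n mod 4 = 2 then (real n ^ 3 - 2 * real n ^ 2 + 4 * real n + 8) / 16
            else (real n ^ 3 - 2 * real n ^ 2 + 5 * real n + 8) / 32)"
  using max_hull_iff(2)[OF assms] c2_formula[OF assms] by blast

end
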